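(* Let $\Gamma$ be a countable discrete group, let $A\in\mathcal{N}\Gamma$ be positive, and injective on $\mathbb{C}\Gamma$, and let $F$ and $F'=F\,\dot\cup\,\{\gamma\}$ be finite subsets of $\Gamma$, where $\gamma\in\Gamma\setminus F$. Let $\Phi_\gamma=\gamma-i_FA_F^{-1}p_FA\gamma\in\mathbb{C}F'\subset\mathbb{C}\Gamma$ and let $\tilde\Phi_\gamma\in\mathbb{C}\Gamma\subset\mathcal{N}\Gamma$ be its image under the map $\sum_{\delta}f_{\delta}\delta\mapsto\sum_{\delta}f_{\delta}\delta^{-1}$. Then $$(\det\nolimits_{\mathcal{N}\Gamma}A)\,(\det\nolimits_{\mathcal{N}\Gamma}\tilde\Phi_\gamma)^2\;\le\;\frac{\det A_{F'}}{\det A_F}.$$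
   Context: For a discrete group $\Gamma$, $L^2(\Gamma)$ is the Hilbert space of formal series $\sum_\gamma x_\gamma\gamma$ with $\sum_\gamma|x_\gamma|^2<\infty$, with scalar product $(\cdot,\cdot)$ for which the elements of $\Gamma$ form an orthonormal basis; $\mathbb{C}\Gamma\subset L^2(\Gamma)$ is the subspace of finite sums. The von Neumann algebra $\mathcal{N}\Gamma$ is the algebra of bounded operators $A: L^2(\Gamma)\to L^2(\Gamma)$ that commute with left multiplication by every $\gamma\in\Gamma$; its canonical trace is $\tau(A)=(Ae,e)$ with $e\in\Gamma\subset L^2(\Gamma)$ the unit element. "Positive" means positive semidefinite. Fuglede–Kadison determinant: for invertible $A\in\mathcal{N}\Gamma$, $\det_{\mathcal{N}\Gamma}A = \exp \tau(\log|A|)$ with $|A|=(A^*A)^{1/2}$; for arbitrary $A\in\mathcal{N}\Gamma$, $\det_{\mathcal{N}\Gamma}A=\lim_{\varepsilon\to0+}\det_{\mathcal{N}\Gamma}(|A|+\varepsilon)\in[0,\infty)$. The group ring $\mathbb{C}\Gamma$ is viewed as a subalgebra of $\mathcal{N}\Gamma$ via the injective homomorphism $r(\sum_\gamma f_\gamma\gamma)=\sum_\gamma f_\gamma R_{\gamma^{-1}}$, where $R_\gamma(x)=x\gamma$ on $L^2(\Gamma)$; thus $\det_{\mathcal{N}\Gamma}f$ means $\det_{\mathcal{N}\Gamma}r(f)$, and $r(f)$ is right multiplication by $\tilde f=\sum_\gamma f_\gamma\gamma^{-1}$. For a finite subset $F\subset\Gamma$ let $\mathbb{C}F\subset L^2(\Gamma)$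 be the span of $F$, $i_F:\mathbb{C}F\hookrightarrow L^2(\Gamma)$ the inclusion and $p_F:L^2(\Gamma)\to\mathbb{C}F$ the orthogonal projection; for $A\in\mathcal{N}\Gamma$ put $A_F=p_F A\, i_F\in\operatorname{End}(\mathbb{C}F)$. If $A$ is positive, and injective on $\mathbb{C}\Gamma$, then $A_F$ is a positive automorphism of $\mathbb{C}F$ and $\det A_F>0$. The element $\Phi_\gamma$ is the orthogonal projection of $\gamma$ onto the orthogonal complement of $\mathbb{C}F$ in $\mathbb{C}F'$ with respect to the scalar product $(u,v)_A:=(Au,v)$. *)

theory Defs
  imports
    "HOL-Analysis.Analysis"
    "HOL-Combinatorics.Permutations"
    "HOL-Computational_Algebra.Polynomial"
    "HOL-Library.Complex_Order"
begin

section \<open>The Hilbert space of square-summable families\<close>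

lemma square_summable_add:
  fixes x y :: "'a \<Rightarrow> complex"
  assumes "(\<lambda>g. (cmod (x g))\<^sup>2) summable_on UNIV" "(\<lambda>g. (cmod (y g))\<^sup>2) summable_on UNIV"
  shows "(\<lambda>g. (cmod (x g + y g))\<^sup>2) summable_on UNIV"
proof (rule summable_on_comparison_test)
  show "(\<lambda>g. 2 * (cmod (x g))\<^sup>2 + 2 * (cmod (y g))\<^sup>2) summable_on UNIV"
    by (intro summable_on_add summable_on_cmult_right assms)
  fix g
  have "(cmod (x g + y g))\<^sup>2 \<le> (cmod (x g) + cmod (y g))\<^sup>2"
    by (intro power_mono norm_triangle_ineq) auto
  also have "\<dots> \<le> 2 * (cmod (x g))\<^sup>2 + 2 * (cmod (y g))\<^sup>2"
    using sum_squares_bound[of "cmod (x g)" "cmod (y g)"] by (simp add: power2_sum)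
  finally show "(cmod (x g + y g))\<^sup>2 \<le> 2 * (cmod (x g))\<^sup>2 + 2 * (cmod (y g))\<^sup>2" .
qed auto

lemma square_summable_scale:
  fixes x :: "'a \<Rightarrow> complex"
  assumes "(\<lambda>g. (cmod (x g))\<^sup>2) summable_on UNIV"
  shows "(\<lambda>g. (cmod (c * x g))\<^sup>2) summable_on UNIV"
  using summable_on_cmult_right[OF assms, of "(cmod c)\<^sup>2"]
  by (simp add: norm_mult power_mult_distrib)

lemma square_summable_mult:
  fixes x y :: "'a \<Rightarrow> complex"
  assumes "(\<lambda>g. (cmod (x g))\<^sup>2) summable_on UNIV" "(\<lambda>g. (cmod (y g))\<^sup>2) summable_on UNIV"
  shows "(\<lambda>g. x g * cnj (y g)) summable_on UNIV"
proof (rule abs_summable_summable, rule summable_on_comparison_test)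
  show "(\<lambda>g. (cmod (x g))\<^sup>2 + (cmod (y g))\<^sup>2) summable_on UNIV"
    by (intro summable_on_add assms)
  fix g
  show "norm (x g * cnj (y g)) \<le> (cmod (x g))\<^sup>2 + (cmod (y g))\<^sup>2"
    using sum_squares_bound[of "cmod (x g)" "cmod (y g)"]
      mult_nonneg_nonneg[OF norm_ge_zero norm_ge_zero, of "x g" "y g"]
    unfolding norm_mult complex_mod_cnj mult.assoc by linarith
qed auto

lemma square_summable_reindex:
  fixes x :: "'a \<Rightarrow> complex"
  assumes "(\<lambda>g. (cmod (x g))\<^sup>2) summable_on UNIV" "bij f"
  shows "(\<lambda>g. (cmod (x (f g)))\<^sup>2) summable_on UNIV"
  using summable_on_reindex_bij_betw[OF assms(2), of "\<lambda>g. (cmod (x g))\<^sup>2"] assms(1) by simp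

typedef 'a ell2 = "{x :: 'a \<Rightarrow> complex. (\<lambda>g. (cmod (x g))\<^sup>2) summable_on UNIV}"
  by (rule exI[of _ "\<lambda>_. 0"]) simp

setup_lifting type_definition_ell2

lift_definition cinner :: "'a ell2 \<Rightarrow> 'a ell2 \<Rightarrow> complex"
  is "\<lambda>x y. \<Sum>\<^sub>\<infinity>g. x g * cnj (y g)" .

lift_definition scaleC :: "complex \<Rightarrow> 'a ell2 \<Rightarrow> 'a ell2"  (infixr \<open>*\<^sub>C\<close> 75)
  is "\<lambda>c x g. c * x g"
  using square_summable_scale by blast

lemma cinner_self: "cinner x x = complex_of_real (\<Sum>\<^sub>\<infinity>g. (cmod (Rep_ell2 x g))\<^sup>2)"
proof -
  have "(\<lambda>g. (cmod (Rep_ell2 x g))\<^sup>2) summable_on UNIV" using Rep_ell2[of x] by simp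
  then have "((\<lambda>g. complex_of_real ((cmod (Rep_ell2 x g))\<^sup>2)) has_sum
      complex_of_real (\<Sum>\<^sub>\<infinity>g. (cmod (Rep_ell2 x g))\<^sup>2)) UNIV"
    by (intro has_sum_of_real has_sum_infsum)
  then show ?thesis
    unfolding cinner.rep_eq by (intro infsumI) (simp only: complex_norm_square)
qed

instantiation ell2 :: (type) real_inner
begin

lift_definition zero_ell2 :: "'a ell2" is "\<lambda>_. 0" by simp
lift_definition plus_ell2 :: "'a ell2 \<Rightarrow> 'a ell2 \<Rightarrow> 'a ell2" is "\<lambda>x y g. x g + y g"
  by (rule square_summable_add)
lift_definition uminus_ell2 :: "'a ell2 \<Rightarrow> 'a ell2" is "\<lambda>x g. - x g" by simp
lift_definition minus_ell2 :: "'a ell2 \<Rightarrow> 'a ell2 \<Rightarrow> 'a ell2" is "\<lambda>x y g. x g - y g"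
  using square_summable_add[of _ "\<lambda>g. - _ g"] by simp
lift_definition scaleR_ell2 :: "real \<Rightarrow> 'a ell2 \<Rightarrow> 'a ell2" is "\<lambda>r x g. r *\<^sub>R x g"
  using square_summable_scale by (simp add: scaleR_conv_of_real)
definition inner_ell2 :: "'a ell2 \<Rightarrow> 'a ell2 \<Rightarrow> real" where "inner_ell2 x y = Re (cinner x y)"
definition norm_ell2 :: "'a ell2 \<Rightarrow> real" where "norm_ell2 x = sqrt (inner x x)"
definition dist_ell2 :: "'a ell2 \<Rightarrow> 'a ell2 \<Rightarrow> real" where "dist_ell2 x y = norm (x - y)"
definition sgn_ell2 :: "'a ell2 \<Rightarrow> 'a ell2" where "sgn_ell2 x = inverse (norm x) *\<^sub>R x"
definition uniformity_ell2 :: "('a ell2 \<times> 'a ell2) filter" where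
  "uniformity_ell2 = (INF e\<in>{0<..}. principal {(x, y). dist x y < e})"
definition open_ell2 :: "'a ell2 set \<Rightarrow> bool" where
  "open_ell2 U \<longleftrightarrow> (\<forall>x\<in>U. \<forall>\<^sub>F (x', y) in uniformity. x' = x \<longrightarrow> y \<in> U)"

instance
proof
  fix x y z :: "'a ell2" and r s :: real
  show "x + y + z = x + (y + z)" "x + y = y + x" "0 + x = x" "- x + x = 0" "x - y = x + - y"
    by (transfer; simp add: fun_eq_iff)+
  show "r *\<^sub>R (x + y) = r *\<^sub>R x + r *\<^sub>R y" "(r + s) *\<^sub>R x = r *\<^sub>R x + s *\<^sub>R x"
    "r *\<^sub>R s *\<^sub>R x = (r * s) *\<^sub>R x" "1 *\<^sub>R x = x"
    by (transfer; simp add: fun_eq_iff algebra_simps)+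
  show "dist x y = norm (x - y)" by (rule dist_ell2_def)
  show "sgn x = inverse (norm x) *\<^sub>R x" by (rule sgn_ell2_def)
  show "(uniformity :: ('a ell2 \<times> 'a ell2) filter) = (INF e\<in>{0<..}. principal {(x, y). dist x y < e})"
    by (rule uniformity_ell2_def)
  show "open U \<longleftrightarrow> (\<forall>x\<in>U. \<forall>\<^sub>F (x', y) in uniformity. x' = x \<longrightarrow> y \<in> U)" for U :: "'a ell2 set"
    by (rule open_ell2_def)
  show "norm x = sqrt (inner x x)" by (rule norm_ell2_def)
  show "inner x y = inner y x"
  proof -
    have "cinner x y = cnj (cinner y x)"
      by transfer (simp add: mult.commute flip: infsum_cnj)
    then show ?thesis by (simp add: inner_ell2_def)
  qed
  show "inner (x + y) z = inner x z + inner y z"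
  proof -
    have "cinner (x + y) z = cinner x z + cinner y z"
      by transfer (simp add: distrib_right infsum_add square_summable_mult)
    then show ?thesis by (simp add: inner_ell2_def)
  qed
  show "inner (r *\<^sub>R x) y = r * inner x y"
  proof -
    have "cinner (r *\<^sub>R x) y = complex_of_real r * cinner x y"
      by transfer (simp add: scaleR_conv_of_real mult.assoc infsum_cmult_right')
    then show ?thesis by (simp add: inner_ell2_def)
  qed
  have inner_self: "inner x x = (\<Sum>\<^sub>\<infinity>g. (cmod (Rep_ell2 x g))\<^sup>2)"
    by (simp add: inner_ell2_def cinner_self)
  then show "0 \<le> inner x x" by (simp add: infsum_nonneg)
  show "inner x x = 0 \<longleftrightarrow> x = 0"
  proof
    assume "inner x x = 0"
    then have sum0: "(\<Sum>\<^sub>\<infinity>g. (cmod (Rep_ell2 x g))\<^sup>2) = 0" using inner_self by simp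
    have "(\<lambda>g. (cmod (Rep_ell2 x g))\<^sup>2) summable_on UNIV" using Rep_ell2[of x] by simp
    then have "(cmod (Rep_ell2 x g))\<^sup>2 = 0" for g
      using nonneg_infsum_le_0D[of "\<lambda>g. (cmod (Rep_ell2 x g))\<^sup>2" UNIV g] sum0 by simp
    then show "x = 0" by transfer (simp add: fun_eq_iff)
  next
    assume "x = 0"
    then show "inner x x = 0" using inner_self by (simp add: zero_ell2.rep_eq)
  qed
qed

end

lemma norm_ell2_eq: "norm x = sqrt (\<Sum>\<^sub>\<infinity>g. (cmod (Rep_ell2 x g))\<^sup>2)"
  by (simp add: norm_ell2_def inner_ell2_def cinner_self)

lift_definition ket :: "'a \<Rightarrow> 'a ell2" is "\<lambda>g h. if h = g then 1 else 0"
proof -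
  fix g :: 'a
  show "(\<lambda>h. (cmod (if h = g then 1 else 0))\<^sup>2) summable_on UNIV"
    by (rule summable_on_cong_neutral[THEN iffD1, OF _ _ _ summable_on_finite[of "{g}"]]) auto
qed

section \<open>Bounded operators\<close>

text \<open>
  The library's bounded linear functions are only real-linear; complex linearity of an operator
  is imposed separately.
\<close>

type_synonym 'a ell2_op = "'a ell2 \<Rightarrow>\<^sub>L 'a ell2"

lift_definition scalar_op :: "complex \<Rightarrow> 'a ell2_op" is "\<lambda>c x. c *\<^sub>C x"
proof (rule bounded_linear_intro)
  fix c :: complex and x y :: "'a ell2" and r :: real
  show "c *\<^sub>C (x + y) = c *\<^sub>C x + c *\<^sub>C y" by transfer (simp add: algebra_simps)
  show "c *\<^sub>C (r *\<^sub>R x) = r *\<^sub>R (c *\<^sub>C x)" by transfer simp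
  show "norm (c *\<^sub>C x) \<le> norm x * cmod c"
    by (simp add: norm_ell2_eq scaleC.rep_eq norm_mult power_mult_distrib
        infsum_cmult_right' real_sqrt_mult)
qed

definition complex_linear_op :: "'a ell2_op \<Rightarrow> bool" where
  "complex_linear_op A \<longleftrightarrow> (\<forall>c x. A (c *\<^sub>C x) = c *\<^sub>C A x)"

definition adj_op :: "'a ell2_op \<Rightarrow> 'a ell2_op" where
  "adj_op A = (THE B :: 'a ell2_op. \<forall>x y. cinner (A x) y = cinner x (B y))"

definition positive_op :: "'a ell2_op \<Rightarrow> bool" where
  "positive_op A \<longleftrightarrow> (\<forall>x. 0 \<le> cinner (A x) x)"

definition invertible_op :: "'a ell2_op \<Rightarrow> bool" where
  "invertible_op A \<longleftrightarrow> (\<exists>B. A o\<^sub>L B = id_blinfun \<and> B o\<^sub>L A = id_blinfun)"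

definition spectrum_op :: "'a ell2_op \<Rightarrow> complex set" where
  "spectrum_op A = {z. \<not> invertible_op (A - scalar_op z)}"

definition poly_op :: "real poly \<Rightarrow> 'a ell2_op \<Rightarrow> 'a ell2_op" where
  "poly_op p A = (\<Sum>i\<le>degree p. coeff p i *\<^sub>R (((\<lambda>B. A o\<^sub>L B) ^^ i) id_blinfun))"

text \<open>
  Continuous functional calculus, for self-adjoint operators (whose spectrum is real) and real
  functions continuous on the spectrum: \<open>f(A)\<close> is the norm limit of \<open>p\<^sub>n(A)\<close> for
  polynomials \<open>p\<^sub>n\<close> converging to \<open>f\<close> uniformly on the spectrum of \<open>A\<close>.
\<close>

definition fun_calc :: "(real \<Rightarrow> real) \<Rightarrow> 'a ell2_op \<Rightarrow> 'a ell2_op" where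
  "fun_calc f A = (THE B. \<exists>p :: nat \<Rightarrow> real poly.
     uniform_limit {t. complex_of_real t \<in> spectrum_op A} (\<lambda>n. poly (p n)) f sequentially \<and>
     (\<lambda>n. poly_op (p n) A) \<longlonglongrightarrow> B)"

definition abs_op :: "'a ell2_op \<Rightarrow> 'a ell2_op" where
  "abs_op A = fun_calc sqrt (adj_op A o\<^sub>L A)"

section \<open>The group von Neumann algebra\<close>

text \<open>
  Groups are types of class \<^class>\<open>group_add\<close>, which are not assumed to be commutative:
  the group product is written \<open>+\<close>, the inverse \<open>-\<close> and the unit element \<open>0\<close>.
\<close>

lemma bij_group_translations:
  fixes \<gamma> :: "'g::group_add"
  shows "bij (\<lambda>\<delta>. - \<gamma> + \<delta>)" "bij (\<lambda>\<delta>. \<delta> - \<gamma>)" "bij (\<lambda>\<delta>::'g. - \<delta>)"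
proof -
  show "bij (\<lambda>\<delta>. - \<gamma> + \<delta>)"
    by (rule bij_betw_byWitness[where f' = "\<lambda>\<delta>. \<gamma> + \<delta>"]) (auto simp flip: add.assoc)
  show "bij (\<lambda>\<delta>. \<delta> - \<gamma>)"
    by (rule bij_betw_byWitness[where f' = "\<lambda>\<delta>. \<delta> + \<gamma>"]) auto
  show "bij (\<lambda>\<delta>::'g. - \<delta>)"
    by (rule bij_betw_byWitness[where f' = "\<lambda>\<delta>. - \<delta>"]) auto
qed

lift_definition left_mult :: "'g::group_add \<Rightarrow> 'g ell2 \<Rightarrow> 'g ell2" is "\<lambda>\<gamma> x \<delta>. x (- \<gamma> + \<delta>)"
  using square_summable_reindex[OF _ bij_group_translations(1)] by blast

lift_definition right_mult :: "'g::group_add \<Rightarrow> 'g ell2 \<Rightarrow> 'g ell2" is "\<lambda>\<gamma> x \<delta>. x (\<delta> - \<gamma>)"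
  using square_summable_reindex[OF _ bij_group_translations(2)] by blast

lift_definition right_mult_op :: "'g::group_add \<Rightarrow> 'g ell2_op" is right_mult
proof (rule bounded_linear_intro)
  fix \<gamma> :: 'g and x y :: "'g ell2" and r :: real
  show "right_mult \<gamma> (x + y) = right_mult \<gamma> x + right_mult \<gamma> y" by transfer simp
  show "right_mult \<gamma> (r *\<^sub>R x) = r *\<^sub>R right_mult \<gamma> x" by transfer simp
  show "norm (right_mult \<gamma> x) \<le> norm x * 1"
    using infsum_reindex_bij_betw[OF bij_group_translations(2)[of \<gamma>],
        of "\<lambda>g. (cmod (Rep_ell2 x g))\<^sup>2"]
    by (simp add: norm_ell2_eq right_mult.rep_eq)
qed

definition vN_algebra :: "'g::group_add ell2_op set" where
  "vN_algebra = {A. complex_linear_op A \<and> (\<forall>\<gamma> x. A (left_mult \<gamma> x) = left_mult \<gamma> (A x))}"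

definition vN_trace :: "'g::group_add ell2_op \<Rightarrow> complex" where
  "vN_trace A = cinner (A (ket 0)) (ket 0)"

text \<open>
  The trace of the self-adjoint operator \<open>log |A|\<close> is real, so that taking its real part loses
  nothing.
\<close>

definition fk_det_invertible :: "'g::group_add ell2_op \<Rightarrow> real" where
  "fk_det_invertible A = exp (Re (vN_trace (fun_calc ln (abs_op A))))"

definition fk_det :: "'g::group_add ell2_op \<Rightarrow> real" where
  "fk_det A = Lim (at_right 0) (\<lambda>\<epsilon>. fk_det_invertible (abs_op A + \<epsilon> *\<^sub>R id_blinfun))"

section \<open>The group ring and compressions\<close>

definition fin_span :: "'a set \<Rightarrow> 'a ell2 set" where
  "fin_span F = range (\<lambda>c. \<Sum>g\<in>F. c g *\<^sub>C ket g)"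

definition group_ring :: "'g::group_add ell2 set" where
  "group_ring = (\<Union>F \<in> {F. finite F}. fin_span F)"

definition ring_op :: "'g::group_add ell2 \<Rightarrow> 'g ell2_op" where
  "ring_op f = (\<Sum>\<gamma> | Rep_ell2 f \<gamma> \<noteq> 0. scalar_op (Rep_ell2 f \<gamma>) o\<^sub>L right_mult_op (- \<gamma>))"

lift_definition tilde :: "'g::group_add ell2 \<Rightarrow> 'g ell2" is "\<lambda>f \<delta>. f (- \<delta>)"
  using square_summable_reindex[OF _ bij_group_translations(3)] by blast

definition proj_span :: "'a set \<Rightarrow> 'a ell2 \<Rightarrow> 'a ell2" where
  "proj_span F x = (THE y. y \<in> fin_span F \<and> (\<forall>z\<in>fin_span F. cinner (x - y) z = 0))"

text \<open>The endomorphism \<open>A\<^sub>F\<close>; only its restriction to \<^term>\<open>fin_span F\<close> matters.\<close>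

definition compression :: "'a set \<Rightarrow> 'a ell2_op \<Rightarrow> 'a ell2 \<Rightarrow> 'a ell2" where
  "compression F A x = proj_span F (A x)"

text \<open>
  The determinant of an endomorphism \<open>T\<close> of \<^term>\<open>fin_span F\<close> is that of its matrix in the basis
  \<open>F\<close>, whose \<open>(g, h)\<close> entry is \<open>Rep_ell2 (T (ket h)) g\<close>. It is given by the Leibniz formula over
  the index set \<open>F\<close>, as in the definition of \<^const>\<open>det\<close>, where the index set is a type.
\<close>

definition det_span :: "'a set \<Rightarrow> ('a ell2 \<Rightarrow> 'a ell2) \<Rightarrow> complex" where
  "det_span F T = (\<Sum>p | p permutes F. of_int (sign p) * (\<Prod>g\<in>F. Rep_ell2 (T (ket (p g))) g))"

definition Phi :: "'a ell2_op \<Rightarrow> 'a set \<Rightarrow> 'a \<Rightarrow> 'a ell2" where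
  "Phi A F \<gamma> = ket \<gamma> - inv_into (fin_span F) (compression F A) (proj_span F (A (ket \<gamma>)))"

end

theory Submission
  imports Defs "HOL-Computational_Algebra.Fundamental_Theorem_Algebra"
begin

text \<open>
  Let \<open>B\<close> be right multiplication by \<open>\<Phi> = \<Phi>\<^sub>\<gamma>\<close>, so that \<open>B e = \<Phi>\<close>. Since \<open>A \<Phi>\<close> is
  orthogonal to \<open>F\<close>, replacing a row of the matrix of \<open>A\<^sub>F\<^sub>'\<close> shows that the quotient of determinants is
  \<open>(A \<Phi>, \<Phi>) = \<tau>(B\<^sup>* A B) = \<tau>(A B B\<^sup>*)\<close>.

  Multiplicativity of the Fuglede--Kadison determinant is avoided. Because \<open>\<tau>(f(B\<^sup>* B)) = \<tau>(f(B B\<^sup>*))\<close>,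
  it suffices that \<open>exp (\<tau>(ln X) + \<tau>(ln Y)) \<le> \<tau>(X Y)\<close> for strictly positive \<open>X\<close> and \<open>Y\<close>, applied to
  \<open>X = A + \<epsilon>\<close> and to \<open>Y = (1 + \<epsilon>) B B\<^sup>* + \<epsilon> + \<epsilon>\<^sup>2\<close> as \<open>\<epsilon>\<close> tends to \<open>0\<close>. That inequality is
  \<open>ln u \<le> u - 1\<close> integrated against the pairing \<open>(f, g) \<mapsto> \<tau>(f(X) g(Y))\<close>, which is nonnegative for
  nonnegative \<open>f\<close> and \<open>g\<close>. The trace property is only needed when one factor is a finite sum of right
  translations, where it is immediate.
\<close>

section \<open>The sequence space\<close>

text \<open>\<open>fun_calc\<close> is a definite description over polynomial sequences that
  converge on the spectrum, so it can be used only after the norm of p(A) is bounded by the supremum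
  of |p| over the spectrum. That bound is reached with real polynomials throughout: failure to be
  bounded below passes to a factor, and nonreal roots enter in conjugate pairs. Afterwards an
  interval enclosing the spectrum suffices, and Bernstein polynomials approximate on it. They are
  nonnegative, sum to 1 and reproduce the identity function exactly, which is what turns them into
  weights for two operators that need not commute. The regularization by e serves twice: it keeps
  the logarithm continuous on the interval, and because \<open>fk_det\<close> is an infimum over e,
  every single e already gives an upper bound.\<close>

lemma Rep_ell2_summable [simp]: "(\<lambda>g. (cmod (Rep_ell2 x g))\<^sup>2) summable_on UNIV"
  using Rep_ell2[of x] by simp

lemma cinner_commute: "cinner x y = cnj (cinner y x)"
  by transfer (simp add: mult.commute flip: infsum_cnj)

lemma cinner_add_left: "cinner (x + y) z = cinner x z + cinner y z"
  by transfer (simp add: distrib_right infsum_add square_summable_mult)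

lemma cinner_scaleC_left: "cinner (c *\<^sub>C x) y = c * cinner x y"
  by transfer (simp add: mult.assoc infsum_cmult_right')

lemma cinner_add_right: "cinner z (x + y) = cinner z x + cinner z y"
  by (subst (1 2 3) cinner_commute) (simp add: cinner_add_left)

lemma cinner_scaleC_right: "cinner x (c *\<^sub>C y) = cnj c * cinner x y"
  by (subst (1 2) cinner_commute) (simp add: cinner_scaleC_left)

lemma scaleC_of_real: "complex_of_real r *\<^sub>C x = r *\<^sub>R x"
  by transfer (simp add: scaleR_conv_of_real)

lemma cinner_scaleR_left: "cinner (r *\<^sub>R x) y = complex_of_real r * cinner x y"
  by (simp add: cinner_scaleC_left flip: scaleC_of_real)

lemma cinner_scaleR_right: "cinner x (r *\<^sub>R y) = complex_of_real r * cinner x y"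
  by (simp add: cinner_scaleC_right flip: scaleC_of_real)

lemma cinner_zero_left [simp]: "cinner 0 x = 0"
  using cinner_scaleR_left[of 0 0 x] by simp

lemma cinner_zero_right [simp]: "cinner x 0 = 0"
  using cinner_scaleR_right[of x 0 0] by simp

lemma cinner_sum_left: "cinner (\<Sum>i\<in>I. f i) x = (\<Sum>i\<in>I. cinner (f i) x)"
  by (induction I rule: infinite_finite_induct) (simp_all add: cinner_add_left)

lemma cinner_sum_right: "cinner x (\<Sum>i\<in>I. f i) = (\<Sum>i\<in>I. cinner x (f i))"
  by (induction I rule: infinite_finite_induct) (simp_all add: cinner_add_right)

lemma Re_cinner: "Re (cinner x y) = inner x y"
  by (simp add: inner_ell2_def)

lemma Im_cinner: "Im (cinner x y) = inner x (\<i> *\<^sub>C y)"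
  by (simp add: inner_ell2_def cinner_scaleC_right)

lemma Im_cinner': "Im (cinner x y) = - inner (\<i> *\<^sub>C x) y"
  by (simp add: inner_ell2_def cinner_scaleC_left)

lemma cinner_ket: "cinner x (ket g) = Rep_ell2 x g"
proof -
  have "cinner x (ket g) = (\<Sum>\<^sub>\<infinity>h\<in>{g}. Rep_ell2 x h)"
    unfolding cinner.rep_eq ket.rep_eq by (rule infsum_cong_neutral) auto
  then show ?thesis by simp
qed

lemma ell2_eqI: "(\<And>y. cinner x y = cinner x' y) \<Longrightarrow> x = x'"
  by (metis Rep_ell2_inject cinner_ket ext)

lemma ket_nonzero: "ket g \<noteq> 0"
  by (metis cinner_ket cinner_zero_left ket.rep_eq zero_neq_one)

lemma inner_ket_self: "inner (ket g) (ket g) = 1"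
  by (simp add: inner_ell2_def cinner_ket ket.rep_eq)

lemma norm_ell2_square: "(norm x)\<^sup>2 = (\<Sum>\<^sub>\<infinity>g. (cmod (Rep_ell2 x g))\<^sup>2)"
  unfolding norm_ell2_eq by (simp add: infsum_nonneg)

lemma finite_sum_le_norm_ell2:
  "finite F \<Longrightarrow> (\<Sum>g\<in>F. (cmod (Rep_ell2 x g))\<^sup>2) \<le> (norm x)\<^sup>2"
  unfolding norm_ell2_square by (rule finite_sum_le_infsum) auto

text \<open>Completeness underlies both the Neumann series and the norm limits of polynomials in an
  operator.\<close>

instance ell2 :: (type) banach
proof
  fix X :: "nat \<Rightarrow> 'a ell2" assume "Cauchy X"
  have pt: "cmod (Rep_ell2 x g) \<le> norm x" for x :: "'a ell2" and g
    by (rule power2_le_imp_le) (use finite_sum_le_norm_ell2[of "{g}" x] in auto)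
  have "Cauchy (\<lambda>n. Rep_ell2 (X n) g)" for g
  proof (rule metric_CauchyI)
    fix e :: real assume "e > 0"
    then obtain N where "\<forall>m\<ge>N. \<forall>n\<ge>N. dist (X m) (X n) < e"
      using metric_CauchyD[OF \<open>Cauchy X\<close>] by metis
    then show "\<exists>N. \<forall>m\<ge>N. \<forall>n\<ge>N. dist (Rep_ell2 (X m) g) (Rep_ell2 (X n) g) < e"
      using pt[of "X _ - X _" g] unfolding dist_norm minus_ell2.rep_eq
      by (meson order_le_less_trans)
  qed
  then have "\<exists>l. (\<lambda>n. Rep_ell2 (X n) g) \<longlonglongrightarrow> l" for g
    by (simp add: Cauchy_convergent_iff convergent_def)
  then obtain l where l: "\<And>g. (\<lambda>n. Rep_ell2 (X n) g) \<longlonglongrightarrow> l g" by metis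
  \<comment> \<open>The limit in m is taken inside finite sums, with a bound independent of the
    finite set; this yields both the summability of X n - l and the final norm estimate.\<close>
  have tail: "(\<Sum>g\<in>F. (cmod (Rep_ell2 (X n) g - l g))\<^sup>2) \<le> e\<^sup>2"
    if "\<forall>m\<ge>N. \<forall>n\<ge>N. dist (X m) (X n) < e" "n \<ge> N" "finite F" for e N n F
  proof (rule LIMSEQ_le_const2)
    show "(\<lambda>m. \<Sum>g\<in>F. (cmod (Rep_ell2 (X n) g - Rep_ell2 (X m) g))\<^sup>2)
        \<longlonglongrightarrow> (\<Sum>g\<in>F. (cmod (Rep_ell2 (X n) g - l g))\<^sup>2)"
      by (intro tendsto_intros l)
    have "(\<Sum>g\<in>F. (cmod (Rep_ell2 (X n) g - Rep_ell2 (X m) g))\<^sup>2) \<le> e\<^sup>2" if "m \<ge> N" for m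
    proof -
      have "norm (X n - X m) \<le> e"
        using \<open>m \<ge> N\<close> \<open>n \<ge> N\<close> that(1) \<open>\<forall>m\<ge>N. \<forall>n\<ge>N. dist (X m) (X n) < e\<close>
        by (force simp: dist_norm)
      then have "(norm (X n - X m))\<^sup>2 \<le> e\<^sup>2" by (intro power_mono) auto
      with finite_sum_le_norm_ell2[OF \<open>finite F\<close>, of "X n - X m"] show ?thesis
        by (simp add: minus_ell2.rep_eq)
    qed
    then show "\<exists>M. \<forall>m\<ge>M. (\<Sum>g\<in>F. (cmod (Rep_ell2 (X n) g - Rep_ell2 (X m) g))\<^sup>2) \<le> e\<^sup>2" by blast
  qed
  have summ: "(\<lambda>g. (cmod (Rep_ell2 (X n) g - l g))\<^sup>2) summable_on UNIV"
    if "\<forall>m\<ge>N. \<forall>n\<ge>N. dist (X m) (X n) < e" "n \<ge> N" for e N n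
    by (rule nonneg_bdd_above_summable_on) (use tail[OF that] in \<open>auto intro!: bdd_aboveI\<close>)
  obtain N1 where N1: "\<forall>m\<ge>N1. \<forall>n\<ge>N1. dist (X m) (X n) < 1"
    using metric_CauchyD[OF \<open>Cauchy X\<close>, of 1] by auto
  have "(\<lambda>g. (cmod (Rep_ell2 (X N1) g + (- 1) * (Rep_ell2 (X N1) g - l g)))\<^sup>2) summable_on UNIV"
    by (intro square_summable_add square_summable_scale summ[OF N1]) auto
  then have "(\<lambda>g. (cmod (l g))\<^sup>2) summable_on UNIV" by simp
  then obtain L where L: "Rep_ell2 L = l"
    using Abs_ell2_inverse by (metis mem_Collect_eq)
  have "X \<longlonglongrightarrow> L"
  proof (rule metric_LIMSEQ_I)
    fix e :: real assume "e > 0"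
    then obtain N where N: "\<forall>m\<ge>N. \<forall>n\<ge>N. dist (X m) (X n) < e / 2"
      using metric_CauchyD[OF \<open>Cauchy X\<close>, of "e / 2"] by (metis half_gt_zero)
    have "dist (X n) L < e" if "n \<ge> N" for n
    proof -
      have "(norm (X n - L))\<^sup>2 \<le> (e / 2)\<^sup>2"
        unfolding norm_ell2_square minus_ell2.rep_eq L
        by (rule infsum_le_finite_sums[OF summ[OF N that] tail[OF N that]])
      then have "norm (X n - L) \<le> e / 2" by (rule power2_le_imp_le) (use \<open>e > 0\<close> in simp)
      then show ?thesis using \<open>e > 0\<close> by (simp add: dist_norm)
    qed
    then show "\<exists>N. \<forall>n\<ge>N. dist (X n) L < e" by blast
  qed
  then show "convergent X" by (auto simp: convergent_def)
qed

section \<open>The algebra of bounded operators under composition\<close>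

lemma blinfun_compose_assoc: "(A o\<^sub>L B) o\<^sub>L C = A o\<^sub>L (B o\<^sub>L C)"
  by (rule blinfun_eqI) simp

lemma blinfun_compose_id [simp]: "A o\<^sub>L id_blinfun = A" "id_blinfun o\<^sub>L A = A"
  by (rule blinfun_eqI; simp)+

lemmas blinfun_compose_bilinear =
  bounded_bilinear.add_left[OF bounded_bilinear_blinfun_compose]
  bounded_bilinear.add_right[OF bounded_bilinear_blinfun_compose]
  bounded_bilinear.diff_left[OF bounded_bilinear_blinfun_compose]
  bounded_bilinear.diff_right[OF bounded_bilinear_blinfun_compose]
  bounded_bilinear.scaleR_left[OF bounded_bilinear_blinfun_compose]
  bounded_bilinear.scaleR_right[OF bounded_bilinear_blinfun_compose]

section \<open>Polynomials in an operator\<close>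

lemma poly_op_sum:
  assumes "degree p \<le> n"
  shows "poly_op p A = (\<Sum>i\<le>n. coeff p i *\<^sub>R (((\<lambda>B. A o\<^sub>L B) ^^ i) id_blinfun))"
  unfolding poly_op_def
  by (rule sum.mono_neutral_left) (use assms in \<open>auto simp: coeff_eq_0\<close>)

lemma poly_op_0 [simp]: "poly_op 0 A = 0"
  by (simp add: poly_op_def)

text \<open>Horner's rule, on which the later inductions over polynomials rest. Summing up to
  \<open>Suc (degree p)\<close> covers p = 0 as well, since the extra coefficients vanish.\<close>

lemma poly_op_pCons: "poly_op (pCons a p) A = a *\<^sub>R id_blinfun + (A o\<^sub>L poly_op p A)"
proof -
  have "poly_op (pCons a p) A
      = (\<Sum>i\<le>Suc (degree p). coeff (pCons a p) i *\<^sub>R (((\<lambda>B. A o\<^sub>L B) ^^ i) id_blinfun))"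
    by (rule poly_op_sum) (simp add: degree_pCons_le)
  also have "\<dots> = a *\<^sub>R id_blinfun +
      (\<Sum>i\<le>degree p. coeff p i *\<^sub>R (A o\<^sub>L ((\<lambda>B. A o\<^sub>L B) ^^ i) id_blinfun))"
    by (subst sum.atMost_Suc_shift) simp
  also have "\<dots> = a *\<^sub>R id_blinfun + (A o\<^sub>L poly_op p A)"
    by (simp add: poly_op_def blinfun_compose_bilinear
        bounded_bilinear.sum_right[OF bounded_bilinear_blinfun_compose])
  finally show ?thesis .
qed

lemma poly_op_add: "poly_op (p + q) A = poly_op p A + poly_op q A"
proof (induction p arbitrary: q)
  case (pCons a p)
  show ?case
    by (cases q) (simp add: poly_op_pCons pCons.IH blinfun_compose_bilinear scaleR_add_left)
qed simp

lemma poly_op_smult: "poly_op (smult c p) A = c *\<^sub>R poly_op p A"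
  by (induction p) (simp_all add: poly_op_pCons blinfun_compose_bilinear scaleR_add_right)

lemma poly_op_diff: "poly_op (p - q) A = poly_op p A - poly_op q A"
  using poly_op_add[of "p - q" q A] by simp

lemma poly_op_const: "poly_op [:c:] A = c *\<^sub>R id_blinfun"
  by (simp add: poly_op_pCons)

lemma poly_op_mult: "poly_op (p * q) A = poly_op p A o\<^sub>L poly_op q A"
  by (induction p)
    (simp_all add: poly_op_pCons poly_op_add poly_op_smult blinfun_compose_bilinear blinfun_compose_assoc
      bounded_bilinear.zero_left[OF bounded_bilinear_blinfun_compose])

lemma poly_op_sum_poly: "poly_op (\<Sum>i\<in>I. p i) A = (\<Sum>i\<in>I. poly_op (p i) A)"
  by (induction I rule: infinite_finite_induct) (simp_all add: poly_op_add)

text \<open>One induction serves two purposes: with all three operators equal it makes p(A) commute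
  with A, and applied to the products C D and D C it carries C past a polynomial, as the exchange of
  the two under the trace requires.\<close>

lemma poly_op_commute:
  assumes "A o\<^sub>L C = C o\<^sub>L B"
  shows "poly_op p A o\<^sub>L C = C o\<^sub>L poly_op p B"
proof (induction p)
  case 0
  show ?case by (rule blinfun_eqI) simp
next
  case (pCons a p)
  have "A o\<^sub>L (poly_op p A o\<^sub>L C) = C o\<^sub>L (B o\<^sub>L poly_op p B)"
    using pCons.IH assms by (metis blinfun_compose_assoc)
  then show ?case
    by (simp add: poly_op_pCons blinfun_compose_bilinear blinfun_compose_assoc)
qed

section \<open>Hermitian operators\<close>

text \<open>Operators are only real-linear, and symmetry for \<open>inner\<close> would admit
  complex conjugation. Symmetry for \<open>cinner\<close> excludes it and forces complex
  linearity.\<close>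

definition hermitian :: "'a ell2_op \<Rightarrow> bool" where
  "hermitian A \<longleftrightarrow> (\<forall>x y. cinner (A x) y = cinner x (A y))"

lemma hermitian_inner:
  fixes A :: "'a ell2_op"
  shows "hermitian A \<Longrightarrow> inner (A x) y = inner x (A y)"
  by (simp add: hermitian_def inner_ell2_def)

text \<open>The two assumptions are the real and imaginary parts of the defining identity, written
  with \<open>inner\<close> alone, so that limits of real inner products can establish it.\<close>

lemma hermitianI:
  fixes A :: "'a ell2_op"
  assumes "\<And>x y. inner (A x) y = inner x (A y)"
    "\<And>x y. inner (A x) (\<i> *\<^sub>C y) = - inner (\<i> *\<^sub>C x) (A y)"
  shows "hermitian A"
  unfolding hermitian_def
proof (intro allI complex_eqI)
  fix x y
  show "Re (cinner (A x) y) = Re (cinner x (A y))"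
    by (simp add: Re_cinner assms(1))
  show "Im (cinner (A x) y) = Im (cinner x (A y))"
    unfolding Im_cinner[of "A x"] Im_cinner'[of x] by (rule assms(2))
qed

lemma hermitian_id [simp]: "hermitian id_blinfun"
  by (simp add: hermitian_def)

lemma hermitian_add: "hermitian A \<Longrightarrow> hermitian B \<Longrightarrow> hermitian (A + B)"
  by (simp add: hermitian_def blinfun.add_left cinner_add_left cinner_add_right)

lemma hermitian_scaleR: "hermitian A \<Longrightarrow> hermitian (c *\<^sub>R A)"
  by (simp add: hermitian_def blinfun.scaleR_left cinner_scaleR_left cinner_scaleR_right)

lemma hermitian_diff: "hermitian A \<Longrightarrow> hermitian B \<Longrightarrow> hermitian (A - B)"
  using hermitian_add[OF _ hermitian_scaleR[of B "-1"]] by simp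

lemma hermitian_poly_op: "hermitian A \<Longrightarrow> hermitian (poly_op p A)"
proof (induction p)
  case 0
  show ?case by (simp add: hermitian_def)
next
  case (pCons a p)
  have "A o\<^sub>L poly_op p A = poly_op p A o\<^sub>L A"
    using poly_op_commute[of A A A p] by simp
  then have "A (poly_op p A x) = poly_op p A (A x)" for x
    by (metis blinfun_apply_blinfun_compose)
  then have "hermitian (A o\<^sub>L poly_op p A)"
    using pCons.IH[OF pCons.prems] pCons.prems by (simp add: hermitian_def)
  then show ?case
    by (simp add: poly_op_pCons hermitian_add hermitian_scaleR)
qed

lemma hermitian_limit:
  assumes "T \<longlonglongrightarrow> B" "\<And>n. hermitian (T n)"
  shows "hermitian B"
proof (rule hermitianI)
  have lim: "(\<lambda>n. inner (T n x) y) \<longlonglongrightarrow> inner (B x) y" "(\<lambda>n. inner x (T n y)) \<longlonglongrightarrow> inner x (B y)" for x y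
    by (intro tendsto_intros blinfun.tendsto assms)+
  fix x y
  show "inner (B x) y = inner x (B y)"
    using lim[of x y] by (simp add: hermitian_inner[OF assms(2)] LIMSEQ_unique)
  have "inner (T n x) (\<i> *\<^sub>C y) = - inner (\<i> *\<^sub>C x) (T n y)" for n
    using assms(2)[of n] by (metis Im_cinner Im_cinner' hermitian_def)
  then have "(\<lambda>n. inner (T n x) (\<i> *\<^sub>C y)) \<longlonglongrightarrow> - inner (\<i> *\<^sub>C x) (B y)"
    using tendsto_minus[OF lim(2)[of "\<i> *\<^sub>C x" y]] by simp
  then show "inner (B x) (\<i> *\<^sub>C y) = - inner (\<i> *\<^sub>C x) (B y)"
    using lim(1)[of x "\<i> *\<^sub>C y"] LIMSEQ_unique by blast
qed

section \<open>Adjoints, positivity and the numerical radius\<close>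

lemma adj_op_eqI:
  fixes A B :: "'a ell2_op"
  assumes "\<And>x y. cinner (A x) y = cinner x (B y)"
  shows "adj_op A = B"
  unfolding adj_op_def
proof (rule the_equality)
  show "\<forall>x y. cinner (A x) y = cinner x (B y)" using assms by blast
  fix C :: "'a ell2_op" assume C: "\<forall>x y. cinner (A x) y = cinner x (C y)"
  show "C = B"
  proof (rule blinfun_eqI, rule ell2_eqI)
    fix y z show "cinner (C y) z = cinner (B y) z"
      using C assms by (metis cinner_commute)
  qed
qed

text \<open>Polarization: the complex order makes (A x, x) real, so expanding it at x + y compares
  the imaginary parts of (A x, y) and (A y, x), and at x + iy the real parts.\<close>

lemma positive_op_hermitian:
  assumes "complex_linear_op A" "positive_op A"
  shows "hermitian A"
proof -
  have im: "Im (cinner (A x) x) = 0" for x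
    using assms(2) by (simp add: positive_op_def less_eq_complex_def)
  have lin: "A (c *\<^sub>C x) = c *\<^sub>C A x" for c x
    using assms(1) by (simp add: complex_linear_op_def)
  have s: "Im (cinner (A x) y) + Im (cinner (A y) x) = 0" for x y
    using im[of "x + y"] im[of x] im[of y]
    by (simp add: blinfun.add_right cinner_add_left cinner_add_right)
  have "cinner (A x) y = cnj (cinner (A y) x)" for x y
    using s[of x y] s[of x "\<i> *\<^sub>C y"]
    by (simp add: complex_eq_iff lin cinner_scaleC_left cinner_scaleC_right)
  then show ?thesis
    unfolding hermitian_def using cinner_commute by metis
qed

text \<open>Polarization and the parallelogram law turn a bound on (A x, x) into one on (A x, y); a
  vector y in the direction of A x then recovers the norm.\<close>

lemma norm_le_of_numerical_radius:
  fixes A :: "'a ell2_op"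
  assumes "hermitian A" "\<And>x. \<bar>inner (A x) x\<bar> \<le> c * inner x x"
  shows "norm A \<le> c"
proof -
  have c: "0 \<le> c"
    using assms(2)[of "ket undefined"] by (simp add: inner_ket_self)
  have pol: "4 * inner (A x) y \<le> 2 * c * (inner x x + inner y y)" for x y
  proof -
    have "4 * inner (A x) y = inner (A (x + y)) (x + y) - inner (A (x - y)) (x - y)"
      using hermitian_inner[OF assms(1), of y x]
      by (simp add: blinfun.add_right blinfun.diff_right inner_add inner_diff inner_commute)
    also have "\<dots> \<le> c * inner (x + y) (x + y) + c * inner (x - y) (x - y)"
      using assms(2)[of "x + y"] assms(2)[of "x - y"] by linarith
    also have "\<dots> = 2 * c * (inner x x + inner y y)"
      by (simp add: inner_add inner_diff inner_commute algebra_simps)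
    finally show ?thesis .
  qed
  have "norm (A x) \<le> c * norm x" for x
  proof (cases "A x = 0 \<or> x = 0")
    case False
    \<comment> \<open>The vector is rescaled to the length of x, so that the two squares in
      \<open>pol\<close> coincide.\<close>
    define y where "y = (norm x / norm (A x)) *\<^sub>R A x"
    have "inner (A x) y = norm x * norm (A x)"
      using False by (simp add: y_def power2_norm_eq_inner[symmetric] power2_eq_square)
    moreover have "inner y y = (norm x)\<^sup>2"
      using False by (simp add: y_def power2_norm_eq_inner[symmetric])
    ultimately have "norm x * norm (A x) \<le> norm x * (c * norm x)"
      using pol[of x y] by (simp add: power2_norm_eq_inner[symmetric] power2_eq_square mult.left_commute)
    then show ?thesis using False by simp
  qed (use c in auto)
  then show ?thesis by (intro norm_blinfun_bound c)
qed

section \<open>Invertibility, the Neumann series and the real spectrum\<close>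

lemma invertible_op_diff_id:
  fixes S :: "'a ell2_op"
  assumes "norm S < 1"
  shows "invertible_op (id_blinfun - S)"
proof -
  define P where "P = (\<lambda>i. ((\<lambda>B. S o\<^sub>L B) ^^ i) id_blinfun)"
  have P: "P 0 = id_blinfun" "P (Suc i) = S o\<^sub>L P i" for i by (simp_all add: P_def)
  \<comment> \<open>Powers of S commute with S, so the same telescoping series is a left and a right
    inverse.\<close>
  have P': "P (Suc i) = P i o\<^sub>L S" for i
    by (induction i) (simp add: P, metis P(2) blinfun_compose_assoc)
  have "norm (P i) \<le> norm S ^ i" for i
  proof (induction i)
    case 0
    show ?case by (simp add: P norm_blinfun_id_le)
  next
    case (Suc i)
    have "norm (P (Suc i)) \<le> norm S * norm (P i)"
      unfolding P by (rule norm_blinfun_compose)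
    also have "\<dots> \<le> norm S * norm S ^ i"
      by (intro mult_left_mono Suc.IH) simp
    finally show ?case by simp
  qed
  then have sP: "summable P"
    using summable_comparison_test'[of "\<lambda>i. norm S ^ i" 0 P] assms by (simp add: summable_geometric)
  have tel: "(\<lambda>i. P i - P (Suc i)) sums (P 0 - 0)"
    by (rule telescope_sums'[OF summable_LIMSEQ_zero[OF sP]])
  have "(\<lambda>i. (id_blinfun - S) o\<^sub>L P i) sums ((id_blinfun - S) o\<^sub>L suminf P)"
    "(\<lambda>i. P i o\<^sub>L (id_blinfun - S)) sums (suminf P o\<^sub>L (id_blinfun - S))"
    by (intro bounded_linear.sums[OF bounded_bilinear.bounded_linear_right[OF bounded_bilinear_blinfun_compose]]
        bounded_linear.sums[OF bounded_bilinear.bounded_linear_left[OF bounded_bilinear_blinfun_compose]]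
        summable_sums sP)+
  moreover have "(id_blinfun - S) o\<^sub>L P i = P i - P (Suc i)" "P i o\<^sub>L (id_blinfun - S) = P i - P (Suc i)" for i
    by (simp_all add: blinfun_compose_bilinear P' P(2)[symmetric])
  ultimately have "(id_blinfun - S) o\<^sub>L suminf P = id_blinfun" "suminf P o\<^sub>L (id_blinfun - S) = id_blinfun"
    using sums_unique2[OF _ tel] P(1) by auto
  then show ?thesis unfolding invertible_op_def by blast
qed

lemma invertible_op_scaleR:
  assumes "invertible_op A" "c \<noteq> 0"
  shows "invertible_op (c *\<^sub>R A)"
proof -
  obtain B where "A o\<^sub>L B = id_blinfun" "B o\<^sub>L A = id_blinfun"
    using assms(1) unfolding invertible_op_def by blast
  then have "(c *\<^sub>R A) o\<^sub>L (inverse c *\<^sub>R B) = id_blinfun" "(inverse c *\<^sub>R B) o\<^sub>L (c *\<^sub>R A) = id_blinfun"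
    using assms(2) by (simp_all add: blinfun_compose_bilinear)
  then show ?thesis unfolding invertible_op_def by blast
qed

lemma invertible_op_bounded_below:
  fixes A :: "'a ell2_op"
  assumes "invertible_op A"
  obtains c where "c > 0" "\<And>x. c * norm x \<le> norm (A x)"
proof -
  obtain B where "B o\<^sub>L A = id_blinfun"
    using assms unfolding invertible_op_def by blast
  then have "x = B (A x)" for x
    by (metis blinfun_apply_blinfun_compose blinfun_apply_id_blinfun id_apply)
  then have B: "norm x \<le> norm B * norm (A x)" for x
    by (metis norm_blinfun)
  have "inverse (norm B + 1) * norm x \<le> norm (A x)" for x
  proof -
    have "norm x \<le> (norm B + 1) * norm (A x)"
      using B[of x] by (simp add: algebra_simps add_increasing)
    then show ?thesis
      using add_nonneg_pos[OF norm_ge_zero[of B] zero_less_one] by (simp add: field_simps)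
  qed
  moreover have "inverse (norm B + 1) > 0"
    using add_nonneg_pos[OF norm_ge_zero[of B] zero_less_one] by simp
  ultimately show ?thesis by (rule that[rotated])
qed

definition real_spectrum :: "'a ell2_op \<Rightarrow> real set" where
  "real_spectrum A = {t. complex_of_real t \<in> spectrum_op A}"

lemma real_spectrum_iff:
  fixes A :: "'a ell2_op"
  shows "t \<in> real_spectrum A \<longleftrightarrow> \<not> invertible_op (A - t *\<^sub>R id_blinfun)"
proof -
  have "scalar_op (complex_of_real t) = t *\<^sub>R (id_blinfun :: 'a ell2_op)"
    by (rule blinfun_eqI) (simp add: scalar_op.rep_eq scaleC_of_real blinfun.scaleR_left)
  then show ?thesis by (simp add: real_spectrum_def spectrum_op_def)
qed

section \<open>The norm of a polynomial in a Hermitian operator\<close>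

text \<open>Its failure is membership of 0 in the approximate point spectrum. The property is stable
  under composition, so when it fails for a product it fails for a factor.\<close>

definition bounded_below :: "'a ell2_op \<Rightarrow> bool" where
  "bounded_below A \<longleftrightarrow> (\<exists>c>0. \<forall>x. c * norm x \<le> norm (A x))"

lemma bounded_below_compose:
  assumes "bounded_below A" "bounded_below B"
  shows "bounded_below (A o\<^sub>L B)"
proof -
  obtain a b where ab: "a > 0" "\<And>x. a * norm x \<le> norm (A x)" "b > 0" "\<And>x. b * norm x \<le> norm (B x)"
    using assms unfolding bounded_below_def by blast
  have "a * b * norm x \<le> norm ((A o\<^sub>L B) x)" for x
  proof -
    have "a * (b * norm x) \<le> a * norm (B x)"
      using ab by simp
    also have "\<dots> \<le> norm (A (B x))" by (rule ab)
    finally show ?thesis by simp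
  qed
  then show ?thesis
    unfolding bounded_below_def using ab by (intro exI[of _ "a * b"]) simp
qed

lemma not_bounded_below_spectrum: "\<not> bounded_below (A - t *\<^sub>R id_blinfun) \<Longrightarrow> t \<in> real_spectrum A"
  unfolding real_spectrum_iff bounded_below_def by (metis invertible_op_bounded_below)

text \<open>The polynomial is (t - a)^2 + b^2, and the square of the Hermitian operator A - a is
  positive. This expresses in real terms that a + ib is not a spectral value of A.\<close>

lemma quadratic_bounded_below:
  assumes "hermitian A" "b \<noteq> 0"
  shows "bounded_below (poly_op [:a\<^sup>2 + b\<^sup>2, - 2 * a, 1:] A)"
proof -
  define C where "C = A - a *\<^sub>R id_blinfun"
  have C: "hermitian C"
    unfolding C_def by (intro hermitian_diff hermitian_scaleR assms hermitian_id)
  have eq: "poly_op [:a\<^sup>2 + b\<^sup>2, - 2 * a, 1:] A x = C (C x) + b\<^sup>2 *\<^sub>R x" for x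
    by (simp add: poly_op_pCons C_def blinfun.add_left blinfun.diff_left blinfun.scaleR_left
        blinfun.add_right blinfun.diff_right blinfun.scaleR_right power2_eq_square algebra_simps
        flip: scaleR_add_left)
  have "b\<^sup>2 * norm x \<le> norm (C (C x) + b\<^sup>2 *\<^sub>R x)" for x
  proof (cases "x = 0")
    case False
    have "b\<^sup>2 * (norm x * norm x) \<le> inner (C (C x) + b\<^sup>2 *\<^sub>R x) x"
      using hermitian_inner[OF C, of "C x" x]
      by (simp add: inner_add power2_norm_eq_inner[symmetric] power2_eq_square)
    also have "\<dots> \<le> norm (C (C x) + b\<^sup>2 *\<^sub>R x) * norm x"
      by (rule norm_cauchy_schwarz)
    finally show ?thesis using False by (simp flip: mult.assoc)
  qed simp
  then show ?thesis
    unfolding bounded_below_def eq using assms(2) by (intro exI[of _ "b\<^sup>2"]) simp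
qed

lemma map_poly_of_real_add_mult:
  fixes p q :: "real poly"
  shows "map_poly complex_of_real (p + q) = map_poly complex_of_real p + map_poly complex_of_real q"
    "map_poly complex_of_real (p * q) = map_poly complex_of_real p * map_poly complex_of_real q"
  by (intro poly_eqI; simp add: coeff_map_poly coeff_mult)+

lemma poly_map_poly_of_real:
  "poly (map_poly complex_of_real p) (complex_of_real t) = complex_of_real (poly p t)"
  by (induction p) (simp_all add: map_poly_pCons)

text \<open>The divisor is the real minimal polynomial of z. The remainder is real of degree at most
  one, and it can vanish at a nonreal point only if it is zero.\<close>

lemma real_poly_complex_root_factor:
  fixes q :: "real poly"
  assumes "poly (map_poly complex_of_real q) z = 0" "Im z \<noteq> 0"
  shows "[:(Re z)\<^sup>2 + (Im z)\<^sup>2, - 2 * Re z, 1:] dvd q"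
proof -
  define m where "m = [:(Re z)\<^sup>2 + (Im z)\<^sup>2, - 2 * Re z, 1:]"
  define r where "r = q mod m"
  have "poly (map_poly complex_of_real m) z = 0"
    by (simp add: m_def map_poly_pCons complex_eq_iff power2_eq_square algebra_simps)
  moreover have "map_poly complex_of_real q =
      map_poly complex_of_real m * map_poly complex_of_real (q div m) + map_poly complex_of_real r"
    by (subst mod_mult_div_eq[symmetric, of q m])
      (simp only: r_def map_poly_of_real_add_mult add.commute)
  ultimately have r0: "poly (map_poly complex_of_real r) z = 0"
    using assms(1) by simp
  have "degree r < 2"
    using degree_mod_less[of m q] by (auto simp: m_def r_def)
  then have "r = [:coeff r 0, coeff r 1:]"
    by (intro poly_eqI) (auto simp: coeff_pCons coeff_eq_0 split: nat.splits)
  then have "poly (map_poly complex_of_real [:coeff r 0, coeff r 1:]) z = 0" using r0 by simp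
  then have "coeff r 1 = 0" "coeff r 0 = 0"
    using assms(2) by (auto simp: map_poly_pCons complex_eq_iff)
  then have "r = 0" using \<open>r = [:coeff r 0, coeff r 1:]\<close> by simp
  then show ?thesis by (simp add: r_def m_def mod_eq_0_iff_dvd)
qed

text \<open>A complex root of q yields a real factor f of degree one or two. If f(A) is bounded
  below, the failure passes to the cofactor, of smaller degree; otherwise f is linear and its root
  lies in the spectrum.\<close>

lemma spectrum_root_of_not_bounded_below:
  assumes "hermitian A" "q \<noteq> 0" "\<not> bounded_below (poly_op q A)"
  shows "\<exists>t\<in>real_spectrum A. poly q t = 0"
  using assms(2,3)
proof (induction "degree q" arbitrary: q rule: less_induct)
  case less
  let ?q = "map_poly complex_of_real q"
  show ?case
  proof (cases "degree q = 0")
    case True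
    then obtain c where q: "q = [:c:]" by (metis degree_eq_zeroE)
    then have "c \<noteq> 0" using less.prems by simp
    have "bounded_below (poly_op q A)"
      unfolding bounded_below_def q poly_op_const using \<open>c \<noteq> 0\<close>
      by (intro exI[of _ "\<bar>c\<bar>"]) (simp add: blinfun.scaleR_left)
    then show ?thesis using less.prems by simp
  next
    case False
    then have "degree ?q \<noteq> 0" by (simp add: degree_map_poly)
    then obtain z where z: "poly ?q z = 0"
      using fundamental_theorem_of_algebra[of ?q] constant_degree[of ?q] by auto
    have step: ?thesis if f: "q = f * r" "bounded_below (poly_op f A)" "degree f > 0" for f r
    proof -
      have "r \<noteq> 0" "f \<noteq> 0" using f(1) less.prems(1) by auto
      then have "degree r < degree q" using f(1,3) by (simp add: degree_mult_eq)
      moreover have "\<not> bounded_below (poly_op r A)"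
        using less.prems(2) f(2) bounded_below_compose unfolding f(1) poly_op_mult by blast
      ultimately have "\<exists>t\<in>real_spectrum A. poly r t = 0"
        using less.hyps \<open>r \<noteq> 0\<close> by blast
      then show ?thesis by (auto simp: f(1))
    qed
    show ?thesis
    proof (cases "Im z = 0")
      case True
      then have "z = complex_of_real (Re z)" by (simp add: complex_eq_iff)
      then have "poly q (Re z) = 0"
        using z by (metis of_real_eq_0_iff poly_map_poly_of_real)
      show ?thesis
      proof (cases "bounded_below (poly_op [:- Re z, 1:] A)")
        case True
        obtain r where "q = [:- Re z, 1:] * r"
          using \<open>poly q (Re z) = 0\<close> by (auto simp: poly_eq_0_iff_dvd elim: dvdE)
        from step[OF this True] show ?thesis by simp
      next
        case False
        have "poly_op [:- Re z, 1:] A = A - Re z *\<^sub>R id_blinfun"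
          by (simp add: poly_op_pCons)
        then show ?thesis
          using False not_bounded_below_spectrum \<open>poly q (Re z) = 0\<close> by metis
      qed
    next
      case False
      obtain r where r: "q = [:(Re z)\<^sup>2 + (Im z)\<^sup>2, - 2 * Re z, 1:] * r"
        using real_poly_complex_root_factor[OF z False] by (elim dvdE)
      show ?thesis
        by (rule step[OF r quadratic_bounded_below[OF assms(1) False]]) simp
    qed
  qed
qed

text \<open>Vectors that nearly attain the norm N of T are approximate eigenvectors of T^2 for N^2.
  Expanding the square of |T^2 x - N^2 x| shows that a lower bound c would keep |T x| / |x| away
  from N.\<close>

lemma square_diff_norm_not_bounded_below:
  fixes T :: "'a ell2_op"
  assumes "hermitian T"
  shows "\<not> bounded_below ((T o\<^sub>L T) - (norm T)\<^sup>2 *\<^sub>R id_blinfun)"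
proof
  assume "bounded_below ((T o\<^sub>L T) - (norm T)\<^sup>2 *\<^sub>R id_blinfun)"
  then obtain c where c: "c > 0" "\<And>x. c * norm x \<le> norm (T (T x) - (norm T)\<^sup>2 *\<^sub>R x)"
    unfolding bounded_below_def by (auto simp: blinfun.diff_left blinfun.scaleR_left)
  let ?N = "norm T"
  have main: "c\<^sup>2 * (norm x)\<^sup>2 \<le> 2 * ?N ^ 4 * (norm x)\<^sup>2 - 2 * ?N\<^sup>2 * (norm (T x))\<^sup>2" for x
  proof -
    have "c\<^sup>2 * (norm x)\<^sup>2 \<le> (norm (T (T x) - ?N\<^sup>2 *\<^sub>R x))\<^sup>2"
      using c(2)[of x] c(1) by (simp add: power_mono flip: power_mult_distrib)
    also have "\<dots> = (norm (T (T x)))\<^sup>2 + ?N ^ 4 * (norm x)\<^sup>2 - 2 * ?N\<^sup>2 * inner (T (T x)) x"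
      unfolding power2_norm_eq_inner[of "T (T x) - _"]
      by (simp add: power2_norm_eq_inner inner_diff inner_commute algebra_simps)
    also have "inner (T (T x)) x = (norm (T x))\<^sup>2"
      using hermitian_inner[OF assms, of "T x" x] by (simp add: power2_norm_eq_inner)
    also have "(norm (T (T x)))\<^sup>2 \<le> ?N ^ 4 * (norm x)\<^sup>2"
    proof -
      have "norm (T (T x)) \<le> ?N * norm (T x)" by (rule norm_blinfun)
      also have "\<dots> \<le> ?N * (?N * norm x)" by (intro mult_left_mono norm_blinfun) simp
      finally have "(norm (T (T x)))\<^sup>2 \<le> (?N * (?N * norm x))\<^sup>2" by (rule power_mono) simp
      then show ?thesis by (simp add: power_mult_distrib power4_eq_xxxx power2_eq_square mult_ac)
    qed
    finally show ?thesis by (simp add: mult_ac)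
  qed
  show False
  proof (cases "?N = 0")
    case True
    then show False
      using main[of "ket undefined"] c(1) by (simp add: power2_norm_eq_inner inner_ket_self)
  next
    case False
    then have N: "?N > 0" by simp
    \<comment> \<open>This is \<open>main\<close> solved for |T x|^2, which is why norm zero was
      split off.\<close>
    define k where "k = ?N\<^sup>2 - c\<^sup>2 / (2 * ?N\<^sup>2)"
    have k: "(norm (T x))\<^sup>2 \<le> k * (norm x)\<^sup>2" for x
      using main[of x] N by (simp add: k_def field_simps power4_eq_xxxx power2_eq_square)
    have "(0::real) < (norm (ket undefined :: 'a ell2))\<^sup>2" using ket_nonzero by simp
    with k[of "ket undefined"] have "0 \<le> k"
      by (meson linorder_not_le mult_neg_pos order_le_less_trans zero_le_power2 not_less)
    have "norm (T x) \<le> sqrt k * norm x" for x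
      using real_sqrt_le_mono[OF k[of x]] by (simp add: real_sqrt_mult)
    then have "?N \<le> sqrt k" by (intro norm_blinfun_bound) (auto simp: \<open>0 \<le> k\<close>)
    then have "?N\<^sup>2 \<le> k" by (metis N \<open>0 \<le> k\<close> less_imp_le power_mono real_sqrt_pow2)
    moreover have "c\<^sup>2 / (2 * ?N\<^sup>2) > 0" using c(1) N by simp
    ultimately show False by (simp add: k_def)
  qed
qed

text \<open>
  With \<open>T = p(A)\<close> and \<open>N = \<parallel>T\<parallel>\<close>, the operator \<open>T\<^sup>2 - N\<^sup>2\<close> is not bounded below, hence neither is one of the
  factors \<open>A - t\<close> of the polynomial \<open>p\<^sup>2 - N\<^sup>2\<close>; nonreal roots \<open>t\<close> do not contribute.
\<close>

lemma norm_poly_op_attained: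
  assumes "hermitian A"
  shows "\<exists>t\<in>real_spectrum A. \<bar>poly p t\<bar> = norm (poly_op p A)"
proof -
  have root: "\<exists>t\<in>real_spectrum A. (poly p t)\<^sup>2 = (norm (poly_op p A))\<^sup>2"
    if "p * p - [:(norm (poly_op p A))\<^sup>2:] \<noteq> 0" for p
  proof -
    have "poly_op (p * p - [:(norm (poly_op p A))\<^sup>2:]) A =
        (poly_op p A o\<^sub>L poly_op p A) - (norm (poly_op p A))\<^sup>2 *\<^sub>R id_blinfun"
      by (simp add: poly_op_diff poly_op_mult poly_op_const)
    then have "\<not> bounded_below (poly_op (p * p - [:(norm (poly_op p A))\<^sup>2:]) A)"
      using square_diff_norm_not_bounded_below[OF hermitian_poly_op[OF assms]] by metis
    from spectrum_root_of_not_bounded_below[OF assms that this] show ?thesis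
      by (auto simp: power2_eq_square)
  qed
  have "\<exists>t\<in>real_spectrum A. (poly p t)\<^sup>2 = (norm (poly_op p A))\<^sup>2"
  proof (cases "p * p - [:(norm (poly_op p A))\<^sup>2:] = 0")
    case True
    then have "(poly p t)\<^sup>2 = (norm (poly_op p A))\<^sup>2" for t
      by (metis (no_types) poly_mult poly_pCons poly_0 mult_zero_right add.right_neutral
          power2_eq_square right_minus_eq)
    \<comment> \<open>Since p^2 is constant, every spectral point attains the norm and only
      nonemptiness of the spectrum remains. The polynomial t provides it, as t^2 minus a constant is
      never the zero polynomial.\<close>
    moreover have "[:0, 1:] * [:0, 1:] - [:(norm (poly_op [:0, 1:] A))\<^sup>2:] \<noteq> (0 :: real poly)"
      by simp
    then have "real_spectrum A \<noteq> {}" using root by blast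
    ultimately show ?thesis by blast
  qed (rule root)
  then show ?thesis by (metis norm_ge_zero power2_abs power2_eq_imp_eq abs_ge_zero)
qed

lemma norm_poly_op_le:
  assumes "hermitian A" "\<And>t. t \<in> real_spectrum A \<Longrightarrow> \<bar>poly p t\<bar> \<le> c"
  shows "norm (poly_op p A) \<le> c"
  using norm_poly_op_attained[OF assms(1), of p] assms(2) by metis

section \<open>Bounds of a Hermitian operator\<close>

text \<open>The interval contains the spectrum and is easier to control than the spectrum itself.
  Strictness of m < M permits the rescaling to [0, 1] behind the Bernstein polynomials.\<close>

definition op_bounds :: "'a ell2_op \<Rightarrow> real \<Rightarrow> real \<Rightarrow> bool" where
  "op_bounds A m M \<longleftrightarrow> m < M \<and> hermitian A \<and>
    (\<forall>x. m * inner x x \<le> inner (A x) x \<and> inner (A x) x \<le> M * inner x x)"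

lemma op_boundsD:
  fixes A :: "'a ell2_op"
  assumes "op_bounds A m M"
  shows "m < M" "hermitian A" "m * inner x x \<le> inner (A x) x" "inner (A x) x \<le> M * inner x x"
  using assms by (auto simp: op_bounds_def)

lemma op_bounds_affine:
  assumes "op_bounds A m M" "c > 0"
  shows "op_bounds (c *\<^sub>R A + d *\<^sub>R id_blinfun) (c * m + d) (c * M + d)"
  unfolding op_bounds_def
proof (intro conjI allI)
  show "hermitian (c *\<^sub>R A + d *\<^sub>R id_blinfun)"
    using op_boundsD(2)[OF assms(1)] by (intro hermitian_add hermitian_scaleR hermitian_id)
  show "c * m + d < c * M + d" using assms op_boundsD(1) by auto
  fix x
  show "(c * m + d) * inner x x \<le> inner ((c *\<^sub>R A + d *\<^sub>R id_blinfun) x) x"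
    "inner ((c *\<^sub>R A + d *\<^sub>R id_blinfun) x) x \<le> (c * M + d) * inner x x"
    using mult_left_mono[OF op_boundsD(3)[OF assms(1), of x], of c]
      mult_left_mono[OF op_boundsD(4)[OF assms(1), of x], of c] assms(2)
    by (simp_all add: blinfun.add_left blinfun.scaleR_left inner_add algebra_simps)
qed

text \<open>The added 1 keeps the interval nondegenerate when A = 0.\<close>

lemma op_bounds_norm:
  assumes "hermitian A"
  shows "op_bounds A (- norm A - 1) (norm A + 1)"
proof -
  have "\<bar>inner (A x) x\<bar> \<le> (norm A + 1) * inner x x" for x
  proof -
    have "\<bar>inner (A x) x\<bar> \<le> norm (A x) * norm x" by (rule Cauchy_Schwarz_ineq2)
    also have "\<dots> \<le> norm A * norm x * norm x" by (intro mult_right_mono norm_blinfun) simp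
    also have "\<dots> = norm A * inner x x" by (simp flip: power2_norm_eq_inner add: power2_eq_square)
    also have "\<dots> \<le> (norm A + 1) * inner x x" by (intro mult_right_mono) auto
    finally show ?thesis .
  qed
  then have "(- norm A - 1) * inner x x \<le> inner (A x) x \<and> inner (A x) x \<le> (norm A + 1) * inner x x" for x
    by (simp add: abs_le_iff algebra_simps) (smt (verit))
  moreover have "- norm A - 1 < norm A + 1" using norm_ge_zero[of A] by linarith
  ultimately show ?thesis
    using assms unfolding op_bounds_def by blast
qed

lemma op_bounds_positive:
  fixes A :: "'a ell2_op"
  assumes "hermitian A" "\<And>x. 0 \<le> inner (A x) x"
  shows "op_bounds A 0 (norm A + 1)"
  using op_bounds_norm[OF assms(1)] assms unfolding op_bounds_def by auto

text \<open>After division by the upper bound M, the operator 1 - A/M has norm at most 1 - m/M,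
  which is below 1, and the Neumann series applies.\<close>

lemma invertible_op_of_lower_bound:
  assumes "op_bounds A m M" "0 < m"
  shows "invertible_op A"
proof -
  have M: "0 < M" using assms op_boundsD(1) by fastforce
  define S where "S = id_blinfun - (1 / M) *\<^sub>R A"
  have "hermitian S"
    unfolding S_def by (intro hermitian_diff hermitian_scaleR hermitian_id op_boundsD(2)[OF assms(1)])
  have "\<bar>inner (S x) x\<bar> \<le> (1 - m / M) * inner x x" for x
  proof -
    have "inner (S x) x = inner x x - inner (A x) x / M"
      by (simp add: S_def blinfun.diff_left blinfun.scaleR_left inner_diff)
    moreover have "m * inner x x / M \<le> inner (A x) x / M" "inner (A x) x / M \<le> M * inner x x / M"
      using op_boundsD(3,4)[OF assms(1), of x] M by (intro divide_right_mono; simp)+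
    moreover have "m / M \<le> 1" using op_boundsD(1)[OF assms(1)] M by simp
    then have "0 \<le> (1 - m / M) * inner x x" by simp
    ultimately show ?thesis using M by (simp add: algebra_simps)
  qed
  then have "norm S \<le> 1 - m / M"
    by (rule norm_le_of_numerical_radius[OF \<open>hermitian S\<close>])
  also have "\<dots> < 1" using assms(2) M by simp
  finally have "invertible_op (M *\<^sub>R (id_blinfun - S))"
    using M by (intro invertible_op_scaleR invertible_op_diff_id) auto
  then show ?thesis using M by (simp add: S_def)
qed

lemma real_spectrum_bounds:
  assumes "op_bounds A m M" "t \<in> real_spectrum A"
  shows "t \<in> {m..M}"
proof (rule ccontr)
  assume "t \<notin> {m..M}"
  then consider "t < m" | "M < t" by fastforce
  then have "invertible_op (A - t *\<^sub>R id_blinfun)"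
  proof cases
    case 1
    then show ?thesis
      using invertible_op_of_lower_bound op_bounds_affine[OF assms(1), of 1 "- t"] by fastforce
  next
    case 2
    have "op_bounds (t *\<^sub>R id_blinfun - A) (t - M) (t - m)"
      using op_boundsD[OF assms(1)] unfolding op_bounds_def
      by (auto simp: blinfun.diff_left blinfun.scaleR_left inner_diff algebra_simps
          intro!: hermitian_diff hermitian_scaleR)
    then have "invertible_op ((-1) *\<^sub>R (t *\<^sub>R id_blinfun - A))"
      using 2 by (intro invertible_op_scaleR invertible_op_of_lower_bound) auto
    then show ?thesis by simp
  qed
  then show False using assms(2) by (simp add: real_spectrum_iff)
qed

lemma norm_poly_op_le_interval:
  assumes "op_bounds A m M" "\<And>t. t \<in> {m..M} \<Longrightarrow> \<bar>poly p t\<bar> \<le> c"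
  shows "norm (poly_op p A) \<le> c"
  using norm_poly_op_le[OF op_boundsD(2)[OF assms(1)]] real_spectrum_bounds[OF assms(1)] assms(2) by blast

text \<open>If 0 \<le> p \<le> c on the interval, then |c - p| \<le> c there, so c - p(A) has norm
  at most c and its quadratic form is at most c (x, x). Positivity thus comes from the norm bound,
  without a square root of p.\<close>

lemma poly_op_nonneg:
  fixes A :: "'a ell2_op"
  assumes "op_bounds A m M" "\<And>t. t \<in> {m..M} \<Longrightarrow> 0 \<le> poly p t"
  shows "0 \<le> inner (poly_op p A x) x"
proof -
  have "bounded (poly p ` {m..M})"
    by (intro compact_imp_bounded compact_continuous_image continuous_intros) auto
  then obtain c where c: "\<And>t. t \<in> {m..M} \<Longrightarrow> \<bar>poly p t\<bar> \<le> c"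
    unfolding bounded_iff by (metis image_eqI real_norm_def)
  have "\<bar>poly ([:c:] - p) t\<bar> \<le> c" if "t \<in> {m..M}" for t
    using c[OF that] assms(2)[OF that] by auto
  then have "norm (poly_op ([:c:] - p) A) \<le> c"
    by (rule norm_poly_op_le_interval[OF assms(1)])
  then have "norm (poly_op ([:c:] - p) A x) * norm x \<le> c * norm x * norm x"
    by (intro mult_right_mono order_trans[OF norm_blinfun]) auto
  then have "inner (poly_op ([:c:] - p) A x) x \<le> c * inner x x"
    using norm_cauchy_schwarz[of "poly_op ([:c:] - p) A x" x]
    by (simp flip: power2_norm_eq_inner add: power2_eq_square)
  then show ?thesis
    by (simp add: poly_op_diff poly_op_const blinfun.diff_left blinfun.scaleR_left inner_diff)
qed

section \<open>Bernstein polynomials on an interval\<close>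

text \<open>The two linear factors are s and 1 - s for the coordinate s = (t - m) / (M - m) on the
  interval.\<close>

definition bernstein_poly :: "real \<Rightarrow> real \<Rightarrow> nat \<Rightarrow> nat \<Rightarrow> real poly" where
  "bernstein_poly m M n k = smult (of_nat (n choose k))
     ([:- m / (M - m), 1 / (M - m):] ^ k * [:M / (M - m), - 1 / (M - m):] ^ (n - k))"

definition bernstein_node :: "real \<Rightarrow> real \<Rightarrow> nat \<Rightarrow> nat \<Rightarrow> real" where
  "bernstein_node m M n k = m + (M - m) * (k / n)"

definition bernstein_approx :: "real \<Rightarrow> real \<Rightarrow> (real \<Rightarrow> real) \<Rightarrow> nat \<Rightarrow> real poly" where
  "bernstein_approx m M f n = (\<Sum>k\<le>n. smult (f (bernstein_node m M n k)) (bernstein_poly m M n k))"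

lemma poly_bernstein_poly:
  assumes "m < M"
  shows "poly (bernstein_poly m M n k) t = Bernstein n k ((t - m) / (M - m))"
proof -
  have "poly [:- m / (M - m), 1 / (M - m):] t = (t - m) / (M - m)"
    "poly [:M / (M - m), - 1 / (M - m):] t = 1 - (t - m) / (M - m)"
    using assms diff_divide_distrib[of M m "M - m"] by (simp_all add: diff_divide_distrib)
  then show ?thesis
    unfolding bernstein_poly_def Bernstein_def by (simp only: poly_smult poly_mult poly_power mult.assoc)
qed

lemma bernstein_poly_nonneg:
  assumes "m < M" "t \<in> {m..M}"
  shows "0 \<le> poly (bernstein_poly m M n k) t"
  using assms by (simp add: poly_bernstein_poly Bernstein_nonneg divide_simps)

lemma bernstein_node_in:
  assumes "m < M" "k \<le> n"
  shows "bernstein_node m M n k \<in> {m..M}"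
proof -
  \<comment> \<open>For n = 0 the quotient is 0 by convention, and the node is m.\<close>
  have "0 \<le> real k / real n" "real k / real n \<le> 1"
    using assms by (auto simp: divide_simps)
  then have "0 \<le> (M - m) * (real k / real n)" "(M - m) * (real k / real n) \<le> (M - m) * 1"
    using assms(1) by (intro mult_nonneg_nonneg mult_left_mono; simp)+
  then show ?thesis by (simp add: bernstein_node_def)
qed

lemma sum_bernstein_poly:
  assumes "m < M"
  shows "(\<Sum>k\<le>n. bernstein_poly m M n k) = [:1:]"
proof -
  have "poly (\<Sum>k\<le>n. bernstein_poly m M n k) = poly [:1:]"
    using assms by (simp add: fun_eq_iff poly_sum poly_bernstein_poly)
  then show ?thesis by (simp only: poly_eq_poly_eq_iff)
qed

text \<open>Exactness on the identity function makes the weighted sum of products of nodes equal to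
  \<tau>(X Y) without an error term. For n = 0 the approximation would be the constant m.\<close>

lemma bernstein_approx_ident:
  assumes "m < M" "n > 0"
  shows "bernstein_approx m M (\<lambda>t. t) n = [:0, 1:]"
proof -
  have "poly (bernstein_approx m M (\<lambda>t. t) n) t = poly [:0, 1:] t" for t
  proof -
    have "poly (bernstein_approx m M (\<lambda>t. t) n) t =
        m * (\<Sum>k\<le>n. Bernstein n k ((t - m) / (M - m))) +
        (M - m) / n * (\<Sum>k\<le>n. real k * Bernstein n k ((t - m) / (M - m)))"
      unfolding bernstein_approx_def bernstein_node_def poly_sum poly_smult poly_bernstein_poly[OF assms(1)]
        sum_distrib_left sum.distrib[symmetric]
      by (rule sum.cong) (simp_all add: algebra_simps)
    also have "\<dots> = t" using assms by simp
    finally show ?thesis by simp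
  qed
  then have "poly (bernstein_approx m M (\<lambda>t. t) n) = poly [:0, 1:]" by (rule ext)
  then show ?thesis by (simp only: poly_eq_poly_eq_iff)
qed

lemma bernstein_approx_uniform_limit:
  assumes "m < M" "continuous_on {m..M} f"
  shows "uniform_limit {m..M} (\<lambda>n. poly (bernstein_approx m M f n)) f sequentially"
  unfolding uniform_limit_sequentially_iff
proof (intro allI impI)
  fix e :: real assume "e > 0"
  have im: "(\<lambda>s. m + (M - m) * s) ` {0..1} \<subseteq> {m..M}"
  proof (rule image_subsetI)
    fix s :: real assume "s \<in> {0..1}"
    then have "0 \<le> (M - m) * s" "(M - m) * s \<le> (M - m) * 1"
      using assms(1) by (intro mult_nonneg_nonneg mult_left_mono; simp)+
    then show "m + (M - m) * s \<in> {m..M}" by simp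
  qed
  have "continuous_on {0..1} (\<lambda>s. f (m + (M - m) * s))"
    by (rule continuous_on_compose2[OF assms(2) _ im]) (intro continuous_intros)
  from Bernstein_Weierstrass[OF this \<open>e > 0\<close>] obtain N where N:
    "\<And>n x. N \<le> n \<Longrightarrow> x \<in> {0..1} \<Longrightarrow>
      \<bar>f (m + (M - m) * x) - (\<Sum>k\<le>n. f (m + (M - m) * (k / n)) * Bernstein n k x)\<bar> < e"
    by blast
  have "dist (poly (bernstein_approx m M f n) t) (f t) < e" if "N \<le> n" "t \<in> {m..M}" for n t
  proof -
    have "(t - m) / (M - m) \<in> {0..1}" using that(2) assms(1) by (simp add: divide_simps)
    from N[OF that(1) this] show ?thesis
      using assms(1) by (simp add: bernstein_approx_def bernstein_node_def poly_sum poly_bernstein_poly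
          dist_real_def abs_minus_commute)
  qed
  then show "\<exists>N. \<forall>n\<ge>N. \<forall>t\<in>{m..M}. dist (poly (bernstein_approx m M f n) t) (f t) < e" by blast
qed

section \<open>Continuous functional calculus\<close>

text \<open>This is the uniqueness behind \<open>fun_calc\<close>. A competing sequence is known to
  converge only on the spectrum, so the norm bound over the spectrum is used and not the one over an
  interval.\<close>

lemma poly_op_limits_agree:
  assumes "hermitian A"
    "uniform_limit (real_spectrum A) (\<lambda>n. poly (p n)) f sequentially"
    "uniform_limit (real_spectrum A) (\<lambda>n. poly (q n)) f sequentially"
  shows "(\<lambda>n. poly_op (p n) A - poly_op (q n) A) \<longlonglongrightarrow> 0"
proof (rule LIMSEQ_I)
  fix e :: real assume "e > 0"
  then have e3: "e / 3 > 0" by simp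
  obtain N where N: "\<And>n t. N \<le> n \<Longrightarrow> t \<in> real_spectrum A \<Longrightarrow> dist (poly (p n) t) (f t) < e / 3"
    using assms(2) e3 unfolding uniform_limit_sequentially_iff by blast
  obtain N' where N': "\<And>n t. N' \<le> n \<Longrightarrow> t \<in> real_spectrum A \<Longrightarrow> dist (poly (q n) t) (f t) < e / 3"
    using assms(3) e3 unfolding uniform_limit_sequentially_iff by blast
  have "norm (poly_op (p n - q n) A) \<le> 2 * (e / 3)" if "max N N' \<le> n" for n
  proof (rule norm_poly_op_le[OF assms(1)])
    fix t assume "t \<in> real_spectrum A"
    then have "dist (poly (p n) t) (f t) < e / 3" "dist (poly (q n) t) (f t) < e / 3"
      using N N' that by auto
    then show "\<bar>poly (p n - q n) t\<bar> \<le> 2 * (e / 3)"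
      unfolding dist_real_def poly_diff by linarith
  qed
  moreover have "2 * (e / 3) < e" using \<open>e > 0\<close> by simp
  ultimately show "\<exists>no. \<forall>n\<ge>no. norm (poly_op (p n) A - poly_op (q n) A - 0) < e"
    by (metis diff_zero order_le_less_trans poly_op_diff)
qed

lemma convergent_poly_op:
  assumes "hermitian A" "uniform_limit (real_spectrum A) (\<lambda>n. poly (p n)) f sequentially"
  shows "convergent (\<lambda>n. poly_op (p n) A)"
proof (rule Cauchy_convergent, rule metric_CauchyI)
  fix e :: real assume "e > 0"
  then have e3: "e / 3 > 0" by simp
  obtain N where N: "\<And>n t. N \<le> n \<Longrightarrow> t \<in> real_spectrum A \<Longrightarrow> dist (poly (p n) t) (f t) < e / 3"
    using assms(2) e3 unfolding uniform_limit_sequentially_iff by blast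
  have "dist (poly_op (p n) A) (poly_op (p k) A) < e" if "N \<le> n" "N \<le> k" for n k
  proof -
    have "norm (poly_op (p n - p k) A) \<le> 2 * (e / 3)"
    proof (rule norm_poly_op_le[OF assms(1)])
      fix t assume "t \<in> real_spectrum A"
      then have "dist (poly (p n) t) (f t) < e / 3" "dist (poly (p k) t) (f t) < e / 3"
        using N that by auto
      then show "\<bar>poly (p n - p k) t\<bar> \<le> 2 * (e / 3)"
        unfolding dist_real_def poly_diff by linarith
    qed
    also have "\<dots> < e" using \<open>e > 0\<close> by simp
    finally show ?thesis by (simp add: dist_norm poly_op_diff)
  qed
  then show "\<exists>N. \<forall>n\<ge>N. \<forall>k\<ge>N. dist (poly_op (p n) A) (poly_op (p k) A) < e" by blast
qed

text \<open>From here on, uniform approximation on an enclosing interval determines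
  \<open>fun_calc\<close>.\<close>

lemma fun_calc_limit:
  assumes "op_bounds A m M" "uniform_limit {m..M} (\<lambda>n. poly (p n)) f sequentially"
  shows "(\<lambda>n. poly_op (p n) A) \<longlonglongrightarrow> fun_calc f A"
proof -
  note h = op_boundsD(2)[OF assms(1)]
  have up: "uniform_limit (real_spectrum A) (\<lambda>n. poly (p n)) f sequentially"
    by (rule uniform_limit_on_subset[OF assms(2)]) (use real_spectrum_bounds[OF assms(1)] in auto)
  obtain B where B: "(\<lambda>n. poly_op (p n) A) \<longlonglongrightarrow> B"
    using convergent_poly_op[OF h up] by (auto simp: convergent_def)
  have "fun_calc f A = B"
    unfolding fun_calc_def real_spectrum_def[symmetric]
  proof (rule the_equality)
    show "\<exists>p. uniform_limit (real_spectrum A) (\<lambda>n. poly (p n)) f sequentially \<and>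
        (\<lambda>n. poly_op (p n) A) \<longlonglongrightarrow> B"
      using up B by blast
    fix C assume "\<exists>p. uniform_limit (real_spectrum A) (\<lambda>n. poly (p n)) f sequentially \<and>
        (\<lambda>n. poly_op (p n) A) \<longlonglongrightarrow> C"
    then obtain q where q: "uniform_limit (real_spectrum A) (\<lambda>n. poly (q n)) f sequentially"
        "(\<lambda>n. poly_op (q n) A) \<longlonglongrightarrow> C" by blast
    have "C - B = 0"
      by (rule LIMSEQ_unique[OF tendsto_diff[OF q(2) B] poly_op_limits_agree[OF h q(1) up]])
    then show "C = B" by simp
  qed
  with B show ?thesis by simp
qed

lemma fun_calc_limit_bernstein:
  assumes "op_bounds A m M" "continuous_on {m..M} f"
  shows "(\<lambda>n. poly_op (bernstein_approx m M f n) A) \<longlonglongrightarrow> fun_calc f A"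
  by (rule fun_calc_limit[OF assms(1) bernstein_approx_uniform_limit[OF op_boundsD(1)[OF assms(1)] assms(2)]])

lemma fun_calc_hermitian:
  assumes "op_bounds A m M" "continuous_on {m..M} f"
  shows "hermitian (fun_calc f A)"
  by (rule hermitian_limit[OF fun_calc_limit_bernstein[OF assms]])
    (rule hermitian_poly_op[OF op_boundsD(2)[OF assms(1)]])

lemma fun_calc_poly:
  assumes "op_bounds A m M" "\<And>t. t \<in> {m..M} \<Longrightarrow> f t = poly p t"
  shows "fun_calc f A = poly_op p A"
proof -
  have "uniform_limit {m..M} (\<lambda>n. poly p) f sequentially"
    using assms(2) by (intro uniform_limit_sequentially_iff[THEN iffD2]) auto
  from fun_calc_limit[OF assms(1) this] show ?thesis
    using LIMSEQ_unique tendsto_const by blast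
qed

lemma fun_calc_norm_diff:
  assumes "op_bounds A m M" "continuous_on {m..M} f" "continuous_on {m..M} g"
    "\<And>t. t \<in> {m..M} \<Longrightarrow> \<bar>f t - g t\<bar> \<le> c"
  shows "norm (fun_calc f A - fun_calc g A) \<le> c"
proof -
  define p where "p n = bernstein_approx m M f n - bernstein_approx m M g n" for n
  have lim: "(\<lambda>n. poly_op (p n) A) \<longlonglongrightarrow> fun_calc f A - fun_calc g A"
    unfolding p_def poly_op_diff by (intro tendsto_diff fun_calc_limit_bernstein assms)
  have ul: "uniform_limit {m..M} (\<lambda>n t. poly (p n) t) (\<lambda>t. f t - g t) sequentially"
    unfolding p_def poly_diff
    by (intro uniform_limit_minus bernstein_approx_uniform_limit assms op_boundsD(1)[OF assms(1)])
  have "norm (fun_calc f A - fun_calc g A) \<le> c + e" if "e > 0" for e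
  proof (rule LIMSEQ_le_const2[OF tendsto_norm[OF lim]])
    obtain N where N: "\<And>n t. N \<le> n \<Longrightarrow> t \<in> {m..M} \<Longrightarrow> dist (poly (p n) t) (f t - g t) < e"
      using ul \<open>e > 0\<close> unfolding uniform_limit_sequentially_iff by blast
    have "norm (poly_op (p n) A) \<le> c + e" if "N \<le> n" for n
      by (rule norm_poly_op_le_interval[OF assms(1)])
        (use N[OF that] assms(4) in \<open>fastforce simp: dist_real_def\<close>)
    then show "\<exists>N. \<forall>n\<ge>N. norm (poly_op (p n) A) \<le> c + e" by blast
  qed
  then show ?thesis by (rule field_le_epsilon)
qed

lemma fun_calc_mono:
  fixes A :: "'a ell2_op"
  assumes "op_bounds A m M" "continuous_on {m..M} f" "continuous_on {m..M} g"
    "\<And>t. t \<in> {m..M} \<Longrightarrow> f t \<le> g t"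
  shows "inner (fun_calc f A x) x \<le> inner (fun_calc g A x) x"
proof -
  define p where "p n = bernstein_approx m M g n - bernstein_approx m M f n" for n
  have lim: "(\<lambda>n. inner (poly_op (p n) A x) x) \<longlonglongrightarrow> inner ((fun_calc g A - fun_calc f A) x) x"
    unfolding p_def poly_op_diff
    by (intro tendsto_inner tendsto_const blinfun.tendsto tendsto_diff fun_calc_limit_bernstein assms)
  have ul: "uniform_limit {m..M} (\<lambda>n t. poly (p n) t) (\<lambda>t. g t - f t) sequentially"
    unfolding p_def poly_diff
    by (intro uniform_limit_minus bernstein_approx_uniform_limit assms op_boundsD(1)[OF assms(1)])
  have "- (e * inner x x) \<le> inner ((fun_calc g A - fun_calc f A) x) x" if "e > 0" for e
  proof (rule LIMSEQ_le_const[OF lim])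
    obtain N where N: "\<And>n t. N \<le> n \<Longrightarrow> t \<in> {m..M} \<Longrightarrow> dist (poly (p n) t) (g t - f t) < e"
      using ul \<open>e > 0\<close> unfolding uniform_limit_sequentially_iff by blast
    have "- (e * inner x x) \<le> inner (poly_op (p n) A x) x" if "N \<le> n" for n
    proof -
      \<comment> \<open>The approximants of g - f may dip below zero by less than e; the added
        constant compensates.\<close>
      have "0 \<le> poly (p n + [:e:]) t" if "t \<in> {m..M}" for t
        using N[OF \<open>N \<le> n\<close> that] assms(4)[OF that] by (simp add: dist_real_def)
      then have "0 \<le> inner (poly_op (p n + [:e:]) A x) x"
        by (rule poly_op_nonneg[OF assms(1)])
      then show ?thesis
        by (simp add: poly_op_add poly_op_const blinfun.add_left blinfun.scaleR_left inner_add)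
    qed
    then show "\<exists>N. \<forall>n\<ge>N. - (e * inner x x) \<le> inner (poly_op (p n) A x) x" by blast
  qed
  then have *: "0 \<le> inner ((fun_calc g A - fun_calc f A) x) x + e * inner x x" if "e > 0" for e
    using that by fastforce
  have "0 \<le> inner ((fun_calc g A - fun_calc f A) x) x"
  proof (rule field_le_epsilon)
    fix e :: real assume "e > 0"
    \<comment> \<open>The error e (x, x) is rescaled to at most e; the added 1 covers x = 0.\<close>
    have pos: "0 < inner x x + 1" using inner_ge_zero[of x] by linarith
    have "e / (inner x x + 1) * inner x x \<le> e"
      using \<open>e > 0\<close> pos by (simp add: field_simps)
    then show "0 \<le> inner ((fun_calc g A - fun_calc f A) x) x + e"
      using *[of "e / (inner x x + 1)"] \<open>e > 0\<close> pos by fastforce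
  qed
  then show ?thesis by (simp add: blinfun.diff_left inner_diff)
qed

lemma fun_calc_op_bounds:
  assumes "op_bounds A m M" "continuous_on {m..M} f" "a < b" "f ` {m..M} \<subseteq> {a..b}"
  shows "op_bounds (fun_calc f A) a b"
  unfolding op_bounds_def
proof (intro conjI allI fun_calc_hermitian[OF assms(1,2)] assms(3))
  fix x
  have const: "fun_calc (\<lambda>_. c) A = c *\<^sub>R id_blinfun" for c
    by (subst fun_calc_poly[OF assms(1), of _ "[:c:]"]) (simp_all add: poly_op_const)
  show "a * inner x x \<le> inner (fun_calc f A x) x"
    using fun_calc_mono[OF assms(1) continuous_on_const assms(2), of a x] assms(4)
    by (auto simp: const blinfun.scaleR_left image_subset_iff)
  show "inner (fun_calc f A x) x \<le> b * inner x x"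
    using fun_calc_mono[OF assms(1,2) continuous_on_const, of b x] assms(4)
    by (auto simp: const blinfun.scaleR_left image_subset_iff)
qed

text \<open>The shape c + f g is that of a Horner step, as used for polynomials in f(A); c = 0 gives
  multiplicativity.\<close>

lemma fun_calc_add_const_mult:
  assumes "op_bounds A m M" "continuous_on {m..M} f" "continuous_on {m..M} g"
  shows "fun_calc (\<lambda>t. c + f t * g t) A = c *\<^sub>R id_blinfun + (fun_calc f A o\<^sub>L fun_calc g A)"
proof -
  define p where "p n = [:c:] + bernstein_approx m M f n * bernstein_approx m M g n" for n
  have bdd: "bounded (h ` {m..M})" if "continuous_on {m..M} h" for h :: "real \<Rightarrow> real"
    by (intro compact_imp_bounded compact_continuous_image that) simp
  have "uniform_limit {m..M} (\<lambda>n t. poly (p n) t) (\<lambda>t. c + f t * g t) sequentially"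
    unfolding p_def poly_add poly_mult
    by (intro uniform_limit_add uniform_lim_mult bernstein_approx_uniform_limit bdd assms op_boundsD(1)[OF assms(1)])
      (simp_all add: uniform_limit_const)
  from fun_calc_limit[OF assms(1) this]
  have "(\<lambda>n. poly_op (p n) A) \<longlonglongrightarrow> fun_calc (\<lambda>t. c + f t * g t) A" .
  moreover have "(\<lambda>n. poly_op (p n) A) \<longlonglongrightarrow> c *\<^sub>R id_blinfun + (fun_calc f A o\<^sub>L fun_calc g A)"
    unfolding p_def poly_op_add poly_op_mult poly_op_const
    by (intro tendsto_add tendsto_const bounded_bilinear.tendsto[OF bounded_bilinear_blinfun_compose]
        fun_calc_limit_bernstein assms)
  ultimately show ?thesis by (rule LIMSEQ_unique)
qed

lemma poly_op_fun_calc: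
  assumes "op_bounds A m M" "continuous_on {m..M} f"
  shows "poly_op p (fun_calc f A) = fun_calc (\<lambda>t. poly p (f t)) A"
proof (induction p)
  case 0
  show ?case by (subst fun_calc_poly[OF assms(1), of _ 0]) simp_all
next
  case (pCons a p)
  have "continuous_on {m..M} (\<lambda>t. poly p (f t))"
    using assms(2) by (intro continuous_intros)
  from fun_calc_add_const_mult[OF assms this, of a] show ?case
    by (simp add: poly_op_pCons pCons.IH)
qed

text \<open>For Bernstein polynomials q_n of g, the operators q_n(f(A)) have both sides as limits:
  one by the calculus of f(A), the other because q_n composed with f converges uniformly to the
  composite.\<close>

lemma fun_calc_compose:
  assumes "op_bounds A m M" "continuous_on {m..M} f" "a < b" "f ` {m..M} \<subseteq> {a..b}" "continuous_on {a..b} g"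
  shows "fun_calc g (fun_calc f A) = fun_calc (\<lambda>t. g (f t)) A"
proof -
  define q where "q = bernstein_approx a b g"
  have gf: "continuous_on {m..M} (\<lambda>t. g (f t))"
    by (rule continuous_on_compose2[OF assms(5,2,4)])
  have qf: "continuous_on {m..M} (\<lambda>t. poly (q n) (f t))" for n
    using assms(2) by (intro continuous_intros)
  have "(\<lambda>n. poly_op (q n) (fun_calc f A)) \<longlonglongrightarrow> fun_calc g (fun_calc f A)"
    unfolding q_def by (rule fun_calc_limit_bernstein[OF fun_calc_op_bounds[OF assms(1-4)] assms(5)])
  moreover have "(\<lambda>n. poly_op (q n) (fun_calc f A)) \<longlonglongrightarrow> fun_calc (\<lambda>t. g (f t)) A"
  proof (rule LIMSEQ_I)
    fix e :: real assume "e > 0"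
    then obtain N where N: "\<And>n t. N \<le> n \<Longrightarrow> t \<in> {a..b} \<Longrightarrow> dist (poly (q n) t) (g t) < e / 2"
      using bernstein_approx_uniform_limit[OF assms(3,5)]
      unfolding uniform_limit_sequentially_iff q_def by (metis half_gt_zero)
    have "norm (poly_op (q n) (fun_calc f A) - fun_calc (\<lambda>t. g (f t)) A) < e" if "N \<le> n" for n
    proof -
      have "norm (fun_calc (\<lambda>t. poly (q n) (f t)) A - fun_calc (\<lambda>t. g (f t)) A) \<le> e / 2"
        by (rule fun_calc_norm_diff[OF assms(1) qf gf])
          (use N[OF that] assms(4) in \<open>auto simp: dist_real_def image_subset_iff less_imp_le\<close>)
      then show ?thesis
        using \<open>e > 0\<close> by (simp add: poly_op_fun_calc[OF assms(1,2)])
    qed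
    then show "\<exists>N. \<forall>n\<ge>N. norm (poly_op (q n) (fun_calc f A) - fun_calc (\<lambda>t. g (f t)) A) < e" by blast
  qed
  ultimately show ?thesis by (rule LIMSEQ_unique)
qed

lemma fun_calc_affine:
  assumes "op_bounds A m M"
  shows "fun_calc (\<lambda>t. c * t + d) A = c *\<^sub>R A + d *\<^sub>R id_blinfun"
  by (subst fun_calc_poly[OF assms, of _ "[:d, c:]"])
    (simp_all add: poly_op_pCons blinfun_compose_bilinear)

text \<open>On a nonnegative interval the root of t^2 is t. Besides the given positive operator,
  this serves the shifted |S| + e, of which \<open>fk_det_invertible\<close> takes the absolute
  value again.\<close>

lemma abs_op_positive:
  fixes A :: "'a ell2_op"
  assumes "hermitian A" "\<And>x. 0 \<le> inner (A x) x"
  shows "abs_op A = A"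
proof -
  note b = op_bounds_positive[OF assms]
  define M where "M = norm A + 1"
  have M: "0 < M" using op_boundsD(1)[OF b] by (simp add: M_def)
  have b: "op_bounds A 0 M" using b by (simp add: M_def)
  have "adj_op A = A"
    by (rule adj_op_eqI) (use assms(1) in \<open>simp add: hermitian_def\<close>)
  moreover have "A o\<^sub>L A = fun_calc (\<lambda>t. t * t) A"
    by (subst fun_calc_poly[OF b, of _ "[:0, 0, 1:]"])
      (simp_all add: poly_op_pCons algebra_simps)
  moreover have "fun_calc sqrt (fun_calc (\<lambda>t. t * t) A) = fun_calc (\<lambda>t. sqrt (t * t)) A"
  proof (rule fun_calc_compose[OF b])
    show "(\<lambda>t. t * t) ` {0..M} \<subseteq> {0..M * M}"
      by (auto intro!: mult_mono)
  qed (use M in \<open>auto intro!: continuous_intros\<close>)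
  moreover have "fun_calc (\<lambda>t. sqrt (t * t)) A = poly_op [:0, 1:] A"
    by (rule fun_calc_poly[OF b]) auto
  ultimately show ?thesis by (simp add: abs_op_def poly_op_pCons)
qed

section \<open>The group von Neumann algebra and its trace\<close>

lemma scaleC_add_right: "c *\<^sub>C (x + y) = c *\<^sub>C x + c *\<^sub>C y"
  by transfer (simp add: algebra_simps)

lemma scaleC_scaleR_commute: "c *\<^sub>C r *\<^sub>R x = r *\<^sub>R (c *\<^sub>C x)"
  by transfer simp

lemma scaleC_commute: "c *\<^sub>C d *\<^sub>C x = d *\<^sub>C c *\<^sub>C x"
  by transfer (simp add: mult.left_commute)

lemma left_mult_linear:
  "left_mult \<gamma> (x + y) = left_mult \<gamma> x + left_mult \<gamma> y"
  "left_mult \<gamma> (c *\<^sub>C x) = c *\<^sub>C left_mult \<gamma> x"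
  "left_mult \<gamma> (r *\<^sub>R x) = r *\<^sub>R left_mult \<gamma> x"
  by (transfer; simp add: fun_eq_iff)+

lemma vN_algebraD:
  fixes A :: "'g::group_add ell2_op"
  assumes "A \<in> vN_algebra"
  shows "complex_linear_op A" "A (c *\<^sub>C x) = c *\<^sub>C A x" "A (left_mult \<gamma> x) = left_mult \<gamma> (A x)"
  using assms by (auto simp: vN_algebra_def complex_linear_op_def)

lemma vN_algebra_id: "id_blinfun \<in> vN_algebra"
  by (simp add: vN_algebra_def complex_linear_op_def)

lemma vN_algebra_add: "A \<in> vN_algebra \<Longrightarrow> B \<in> vN_algebra \<Longrightarrow> A + B \<in> vN_algebra"
  by (simp add: vN_algebra_def complex_linear_op_def blinfun.add_left scaleC_add_right left_mult_linear)

lemma vN_algebra_scaleR: "A \<in> vN_algebra \<Longrightarrow> r *\<^sub>R A \<in> vN_algebra"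
  by (simp add: vN_algebra_def complex_linear_op_def blinfun.scaleR_left scaleC_scaleR_commute left_mult_linear)

lemma vN_algebra_compose: "A \<in> vN_algebra \<Longrightarrow> B \<in> vN_algebra \<Longrightarrow> A o\<^sub>L B \<in> vN_algebra"
  by (simp add: vN_algebra_def complex_linear_op_def)

lemma vN_algebra_scalar: "scalar_op c \<in> vN_algebra"
  by (simp add: vN_algebra_def complex_linear_op_def scalar_op.rep_eq left_mult_linear scaleC_commute)

lemma vN_algebra_zero: "0 \<in> vN_algebra"
  using vN_algebra_scaleR[OF vN_algebra_id, of 0] by simp

lemma vN_algebra_right_mult: "right_mult_op \<gamma> \<in> vN_algebra"
proof -
  have "right_mult \<gamma> (c *\<^sub>C x) = c *\<^sub>C right_mult \<gamma> x"
    "right_mult \<gamma> (left_mult \<delta> x) = left_mult \<delta> (right_mult \<gamma> x)" for c \<delta> x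
    by (transfer; simp add: fun_eq_iff add_diff_eq)+
  then show ?thesis by (simp add: vN_algebra_def complex_linear_op_def right_mult_op.rep_eq)
qed

lemma vN_algebra_poly_op: "A \<in> vN_algebra \<Longrightarrow> poly_op p A \<in> vN_algebra"
  by (induction p)
    (auto simp: poly_op_pCons vN_algebra_zero intro!: vN_algebra_add vN_algebra_scaleR vN_algebra_compose vN_algebra_id)

lemma vN_trace_add: "vN_trace (A + B) = vN_trace A + vN_trace B"
  by (simp add: vN_trace_def blinfun.add_left cinner_add_left)

lemma vN_trace_scaleR: "vN_trace (r *\<^sub>R A) = complex_of_real r * vN_trace A"
  by (simp add: vN_trace_def blinfun.scaleR_left cinner_scaleR_left)

text \<open>
  The trace property holds on the whole algebra; making it a condition on one factor avoids the
  adjoint of a general operator.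
\<close>

definition tracial :: "'g::group_add ell2_op \<Rightarrow> bool" where
  "tracial T \<longleftrightarrow> T \<in> vN_algebra \<and> (\<forall>S\<in>vN_algebra. vN_trace (S o\<^sub>L T) = vN_trace (T o\<^sub>L S))"

lemma tracial_vN: "tracial T \<Longrightarrow> T \<in> vN_algebra"
  by (simp add: tracial_def)

lemma tracialD: "tracial T \<Longrightarrow> S \<in> vN_algebra \<Longrightarrow> vN_trace (S o\<^sub>L T) = vN_trace (T o\<^sub>L S)"
  by (simp add: tracial_def)

lemma tracial_id: "tracial id_blinfun"
  by (simp add: tracial_def vN_algebra_id)

lemma tracial_add: "tracial A \<Longrightarrow> tracial B \<Longrightarrow> tracial (A + B)"
  by (simp add: tracial_def vN_algebra_add blinfun_compose_bilinear vN_trace_add)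

lemma tracial_compose:
  assumes "tracial A" "tracial B"
  shows "tracial (A o\<^sub>L B)"
  unfolding tracial_def
proof (intro conjI ballI)
  show "A o\<^sub>L B \<in> vN_algebra" using assms by (simp add: tracial_vN vN_algebra_compose)
  fix S :: "'a ell2_op" assume S: "S \<in> vN_algebra"
  have "vN_trace (S o\<^sub>L (A o\<^sub>L B)) = vN_trace (B o\<^sub>L (S o\<^sub>L A))"
    using tracialD[OF assms(2) vN_algebra_compose[OF S tracial_vN[OF assms(1)]]]
    by (simp add: blinfun_compose_assoc)
  also have "\<dots> = vN_trace (A o\<^sub>L (B o\<^sub>L S))"
    using tracialD[OF assms(1) vN_algebra_compose[OF tracial_vN[OF assms(2)] S]]
    by (simp add: blinfun_compose_assoc)
  finally show "vN_trace (S o\<^sub>L (A o\<^sub>L B)) = vN_trace ((A o\<^sub>L B) o\<^sub>L S)"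
    by (simp add: blinfun_compose_assoc)
qed

lemma tracial_scalar: "tracial (scalar_op c)"
  unfolding tracial_def
  by (simp add: vN_algebra_scalar vN_trace_def scalar_op.rep_eq vN_algebraD(2))

lemma tracial_scaleR:
  assumes "tracial A"
  shows "tracial (r *\<^sub>R A)"
  using assms
  by (simp add: tracial_def vN_algebra_scaleR blinfun_compose_bilinear vN_trace_scaleR)

lemma tracial_zero: "tracial 0"
  using tracial_scaleR[OF tracial_id, of 0] by simp

lemma tracial_sum: "(\<And>i. i \<in> I \<Longrightarrow> tracial (T i)) \<Longrightarrow> tracial (\<Sum>i\<in>I. T i)"
  by (induction I rule: infinite_finite_induct) (auto intro: tracial_zero tracial_add)

lemma right_mult_ket: "right_mult \<gamma> (ket 0) = ket \<gamma>"
  by transfer (auto simp: fun_eq_iff)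

lemma left_mult_ket: "left_mult \<gamma> (ket 0) = ket \<gamma>"
  by transfer (auto simp: fun_eq_iff neg_eq_iff_add_eq_0 add_eq_0_iff)

text \<open>Since S commutes with left translations, S \<gamma> = \<gamma> S(e). The unit
  coefficients of \<gamma> S(e) and of S(e) \<gamma> are both the coefficient of S(e) at the inverse
  of \<gamma>.\<close>

lemma tracial_right_mult: "tracial (right_mult_op \<gamma>)"
  unfolding tracial_def
proof (intro conjI ballI vN_algebra_right_mult)
  fix S :: "'a ell2_op" assume S: "S \<in> vN_algebra"
  have "vN_trace (S o\<^sub>L right_mult_op \<gamma>) = Rep_ell2 (left_mult \<gamma> (S (ket 0))) 0"
    by (simp add: vN_trace_def right_mult_op.rep_eq right_mult_ket cinner_ket vN_algebraD(3)[OF S]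
        left_mult_ket[of \<gamma>, symmetric])
  also have "\<dots> = vN_trace (right_mult_op \<gamma> o\<^sub>L S)"
    by (simp add: vN_trace_def right_mult_op.rep_eq cinner_ket left_mult.rep_eq right_mult.rep_eq)
  finally show "vN_trace (S o\<^sub>L right_mult_op \<gamma>) = vN_trace (right_mult_op \<gamma> o\<^sub>L S)" .
qed

lemma tracial_poly_op: "tracial A \<Longrightarrow> tracial (poly_op p A)"
  by (induction p)
    (auto simp: poly_op_pCons tracial_zero intro!: tracial_add tracial_scaleR tracial_compose tracial_id)

lemma tracial_ring_op: "tracial (ring_op f)"
  unfolding ring_op_def by (intro tracial_sum tracial_compose tracial_scalar tracial_right_mult)

section \<open>The real part of the trace, and its positivity on products\<close>

definition re_trace :: "'g::group_add ell2_op \<Rightarrow> real" where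
  "re_trace T = inner (T (ket 0)) (ket 0)"

lemma Re_vN_trace: "Re (vN_trace T) = re_trace T"
  by (simp add: vN_trace_def re_trace_def Re_cinner)

lemma re_trace_add: "re_trace (A + B) = re_trace A + re_trace B"
  by (simp add: re_trace_def blinfun.add_left inner_add)

lemma re_trace_scaleR: "re_trace (r *\<^sub>R A) = r * re_trace A"
  by (simp add: re_trace_def blinfun.scaleR_left)

lemma re_trace_id: "re_trace id_blinfun = 1"
  by (simp add: re_trace_def inner_ket_self)

lemma re_trace_zero: "re_trace 0 = 0"
  by (simp add: re_trace_def)

lemma re_trace_sum: "re_trace (\<Sum>i\<in>I. T i) = (\<Sum>i\<in>I. re_trace (T i))"
  by (induction I rule: infinite_finite_induct) (simp_all add: re_trace_zero re_trace_add)

lemma re_trace_commute: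
  "tracial T \<Longrightarrow> S \<in> vN_algebra \<Longrightarrow> re_trace (S o\<^sub>L T) = re_trace (T o\<^sub>L S)"
  using tracialD[of T S] by (metis Re_vN_trace)

lemma tendsto_re_trace:
  assumes "T \<longlonglongrightarrow> B"
  shows "(\<lambda>n. re_trace (T n)) \<longlonglongrightarrow> re_trace B"
  unfolding re_trace_def by (intro tendsto_intros blinfun.tendsto assms)

text \<open>With R the square root of q(Y), the value is \<tau>(R p(X) R) \<ge> 0. Since R is only a
  norm limit, the cyclic step is made for polynomials r_n(Y), which are tracial, and the limit is
  taken afterwards.\<close>

lemma re_trace_poly_op_prod_nonneg:
  assumes X: "op_bounds X a b" "X \<in> vN_algebra" and Y: "op_bounds Y c d" "tracial Y"
    and p: "\<And>t. t \<in> {a..b} \<Longrightarrow> 0 \<le> poly p t" and q: "\<And>t. t \<in> {c..d} \<Longrightarrow> 0 \<le> poly q t"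
  shows "0 \<le> re_trace (poly_op p X o\<^sub>L poly_op q Y)"
proof -
  define r where "r = bernstein_approx c d (\<lambda>t. sqrt (poly q t))"
  have cont: "continuous_on {c..d} (\<lambda>t. sqrt (poly q t))"
    by (intro continuous_intros)
  have "(\<lambda>n. poly_op (r n) Y o\<^sub>L poly_op (r n) Y)
      \<longlonglongrightarrow> (fun_calc (\<lambda>t. sqrt (poly q t)) Y o\<^sub>L fun_calc (\<lambda>t. sqrt (poly q t)) Y)"
    unfolding r_def
    by (intro bounded_bilinear.tendsto[OF bounded_bilinear_blinfun_compose] fun_calc_limit_bernstein Y cont)
  also have "(fun_calc (\<lambda>t. sqrt (poly q t)) Y o\<^sub>L fun_calc (\<lambda>t. sqrt (poly q t)) Y)
      = fun_calc (\<lambda>t. 0 + sqrt (poly q t) * sqrt (poly q t)) Y"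
    using fun_calc_add_const_mult[OF Y(1) cont cont, of 0] by simp
  also have "\<dots> = poly_op q Y"
    by (rule fun_calc_poly[OF Y(1)]) (use q in simp)
  finally have "(\<lambda>n. re_trace (poly_op p X o\<^sub>L (poly_op (r n) Y o\<^sub>L poly_op (r n) Y)))
      \<longlonglongrightarrow> re_trace (poly_op p X o\<^sub>L poly_op q Y)"
    by (intro tendsto_re_trace bounded_bilinear.tendsto[OF bounded_bilinear_blinfun_compose] tendsto_const)
  moreover have "0 \<le> re_trace (poly_op p X o\<^sub>L (poly_op (r n) Y o\<^sub>L poly_op (r n) Y))" for n
  proof -
    let ?r = "poly_op (r n) Y"
    have "re_trace (poly_op p X o\<^sub>L (?r o\<^sub>L ?r)) = re_trace (?r o\<^sub>L (poly_op p X o\<^sub>L ?r))"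
      using re_trace_commute[OF tracial_poly_op[OF Y(2), of "r n"]
          vN_algebra_compose[OF vN_algebra_poly_op[OF X(2), of p] tracial_vN[OF tracial_poly_op[OF Y(2), of "r n"]]]]
      by (simp add: blinfun_compose_assoc)
    also have "\<dots> = inner (poly_op p X (?r (ket 0))) (?r (ket 0))"
      unfolding re_trace_def
      using hermitian_inner[OF hermitian_poly_op[OF op_boundsD(2)[OF Y(1)]]] by simp
    also have "\<dots> \<ge> 0" by (rule poly_op_nonneg[OF X(1) p])
    finally show ?thesis .
  qed
  ultimately show ?thesis by (simp add: LIMSEQ_le_const)
qed

lemma re_trace_bernstein_prod:
  "re_trace (poly_op (bernstein_approx a b f n) X o\<^sub>L poly_op (bernstein_approx c d g n) Y) =
    (\<Sum>i\<le>n. \<Sum>j\<le>n. f (bernstein_node a b n i) * g (bernstein_node c d n j) *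
      re_trace (poly_op (bernstein_poly a b n i) X o\<^sub>L poly_op (bernstein_poly c d n j) Y))"
  unfolding bernstein_approx_def poly_op_sum_poly poly_op_smult
    bounded_bilinear.sum_left[OF bounded_bilinear_blinfun_compose]
    bounded_bilinear.sum_right[OF bounded_bilinear_blinfun_compose]
    blinfun_compose_bilinear re_trace_sum re_trace_scaleR
  by (subst sum.swap) (simp add: sum_distrib_left mult_ac)

text \<open>
  Writing \<open>b\<^sub>i\<close> for the Bernstein polynomials, the numbers \<open>\<tau>(b\<^sub>i(X) b\<^sub>j(Y))\<close> are nonnegative and so
  replace a joint distribution of \<open>X\<close> and \<open>Y\<close>, which need not commute. The inequality is
  \<open>ln (k s t) \<le> k s t - 1\<close> averaged over it; the scaling \<open>k = exp (- L)\<close> makes the linear bound sharp.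
\<close>

lemma exp_re_trace_ln_le:
  assumes X: "op_bounds X a b" "0 < a" "X \<in> vN_algebra" and Y: "op_bounds Y c d" "0 < c" "tracial Y"
  shows "exp (re_trace (fun_calc ln X) + re_trace (fun_calc ln Y)) \<le> re_trace (X o\<^sub>L Y)"
proof -
  define L where "L = re_trace (fun_calc ln X) + re_trace (fun_calc ln Y)"
  define k where "k = exp (- L)"
  define P where "P n = re_trace (poly_op (bernstein_approx a b ln n) X)" for n
  define Q where "Q n = re_trace (poly_op (bernstein_approx c d ln n) Y)" for n
  note ab = op_boundsD(1)[OF X(1)] and cd = op_boundsD(1)[OF Y(1)]
  have one: "bernstein_approx m M (\<lambda>_. 1) n = [:1:]" if "m < M" for m M n
    using sum_bernstein_poly[OF that] by (simp add: bernstein_approx_def)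
  have ineq: "P n + Q n \<le> k * re_trace (X o\<^sub>L Y) - 1 + L" if "n > 0" for n
  proof -
    define s where "s = bernstein_node a b n"
    define t where "t = bernstein_node c d n"
    define w where "w i j = re_trace (poly_op (bernstein_poly a b n i) X o\<^sub>L poly_op (bernstein_poly c d n j) Y)" for i j
    have w: "w i j \<ge> 0" for i j
      unfolding w_def
      by (rule re_trace_poly_op_prod_nonneg[OF X(1,3) Y(1,3)]) (intro bernstein_poly_nonneg ab cd; assumption)+
    \<comment> \<open>The four instances below give \<tau>(X Y), the total mass 1, and the integrals
      of ln against the two marginals.\<close>
    note prod = re_trace_bernstein_prod[of a b _ n X c d _ Y, folded s_def t_def w_def]
    have 1: "(\<Sum>i\<le>n. \<Sum>j\<le>n. s i * t j * w i j) = re_trace (X o\<^sub>L Y)"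
      using prod[of "\<lambda>t. t" "\<lambda>t. t"]
      by (simp add: bernstein_approx_ident[OF ab that] bernstein_approx_ident[OF cd that] poly_op_pCons)
    have 2: "(\<Sum>i\<le>n. \<Sum>j\<le>n. w i j) = 1"
      using prod[of "\<lambda>_. 1" "\<lambda>_. 1"]
      by (simp add: one[OF ab] one[OF cd] poly_op_pCons re_trace_id)
    have 3: "(\<Sum>i\<le>n. \<Sum>j\<le>n. ln (s i) * w i j) = P n"
      using prod[of ln "\<lambda>_. 1"] by (simp add: one[OF cd] poly_op_pCons P_def)
    have 4: "(\<Sum>i\<le>n. \<Sum>j\<le>n. ln (t j) * w i j) = Q n"
      using prod[of "\<lambda>_. 1" ln] by (simp add: one[OF ab] poly_op_pCons Q_def)
    have "0 \<le> (\<Sum>i\<le>n. \<Sum>j\<le>n. (k * (s i * t j) - 1 + L - ln (s i) - ln (t j)) * w i j)"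
    proof (intro sum_nonneg mult_nonneg_nonneg w)
      fix i j assume "i \<in> {..n}" "j \<in> {..n}"
      then have "0 < s i" "0 < t j"
        using bernstein_node_in[OF ab, of i n] bernstein_node_in[OF cd, of j n] X(2) Y(2)
        by (auto simp: s_def t_def)
      then have "ln (k * (s i * t j)) \<le> k * (s i * t j) - 1"
        by (intro ln_le_minus_one) (simp add: k_def)
      moreover have "ln (k * (s i * t j)) = - L + ln (s i) + ln (t j)"
        using \<open>0 < s i\<close> \<open>0 < t j\<close> by (simp add: ln_mult k_def)
      ultimately show "0 \<le> k * (s i * t j) - 1 + L - ln (s i) - ln (t j)" by simp
    qed
    also have "\<dots> = k * (\<Sum>i\<le>n. \<Sum>j\<le>n. s i * t j * w i j) + (L - 1) * (\<Sum>i\<le>n. \<Sum>j\<le>n. w i j)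
        - (\<Sum>i\<le>n. \<Sum>j\<le>n. ln (s i) * w i j) - (\<Sum>i\<le>n. \<Sum>j\<le>n. ln (t j) * w i j)"
      unfolding sum_distrib_left sum.distrib[symmetric] sum_subtractf[symmetric]
      by (intro sum.cong refl) (simp add: algebra_simps)
    finally show ?thesis by (simp add: 1 2 3 4)
  qed
  have "continuous_on {a..b} ln" "continuous_on {c..d} ln"
    using X(2) Y(2) by (auto intro!: continuous_intros)
  then have "(\<lambda>n. P n + Q n) \<longlonglongrightarrow> L"
    unfolding P_def Q_def L_def
    by (intro tendsto_add tendsto_re_trace fun_calc_limit_bernstein X Y)
  then have "L \<le> k * re_trace (X o\<^sub>L Y) - 1 + L"
    by (rule LIMSEQ_le_const2) (use ineq in \<open>auto intro!: exI[of _ 1]\<close>)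
  \<comment> \<open>Cancelling L leaves 1 \<le> k \<tau>(X Y), and k is the inverse of exp
    L.\<close>
  then have "exp L * 1 \<le> exp L * (k * re_trace (X o\<^sub>L Y))"
    by (intro mult_left_mono) auto
  also have "exp L * (k * re_trace (X o\<^sub>L Y)) = re_trace (X o\<^sub>L Y)"
    by (simp add: k_def exp_minus)
  finally show ?thesis by (simp add: L_def)
qed

lemma re_trace_fun_calc_mono:
  assumes "op_bounds A m M" "continuous_on {m..M} f" "continuous_on {m..M} g"
    "\<And>t. t \<in> {m..M} \<Longrightarrow> f t \<le> g t"
  shows "re_trace (fun_calc f A) \<le> re_trace (fun_calc g A)"
  unfolding re_trace_def by (rule fun_calc_mono[OF assms])

text \<open>Constant terms agree. For t q(t), the trace property moves C to the right end of D q(C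
  D), and intertwining turns q(C D) C into C q(D C).\<close>

lemma re_trace_poly_op_swap:
  assumes "tracial C" "D \<in> vN_algebra"
  shows "re_trace (poly_op p (C o\<^sub>L D)) = re_trace (poly_op p (D o\<^sub>L C))"
proof (cases p)
  case (pCons a q)
  have comm: "poly_op q (C o\<^sub>L D) o\<^sub>L C = C o\<^sub>L poly_op q (D o\<^sub>L C)"
    by (rule poly_op_commute) (simp add: blinfun_compose_assoc)
  have "re_trace ((C o\<^sub>L D) o\<^sub>L poly_op q (C o\<^sub>L D)) = re_trace (C o\<^sub>L (D o\<^sub>L poly_op q (C o\<^sub>L D)))"
    by (simp add: blinfun_compose_assoc)
  also have "\<dots> = re_trace ((D o\<^sub>L poly_op q (C o\<^sub>L D)) o\<^sub>L C)"
    by (rule re_trace_commute[OF assms(1), symmetric])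
      (intro vN_algebra_compose vN_algebra_poly_op assms tracial_vN[OF assms(1)])
  also have "\<dots> = re_trace ((D o\<^sub>L C) o\<^sub>L poly_op q (D o\<^sub>L C))"
    by (simp add: blinfun_compose_assoc comm)
  finally show ?thesis
    by (simp add: pCons poly_op_pCons re_trace_add)
qed

lemma re_trace_fun_calc_swap:
  assumes "tracial C" "D \<in> vN_algebra" "op_bounds (C o\<^sub>L D) m M" "op_bounds (D o\<^sub>L C) m M"
    "continuous_on {m..M} f"
  shows "re_trace (fun_calc f (C o\<^sub>L D)) = re_trace (fun_calc f (D o\<^sub>L C))"
  using tendsto_re_trace[OF fun_calc_limit_bernstein[OF assms(3,5)]]
    tendsto_re_trace[OF fun_calc_limit_bernstein[OF assms(4,5)]]
  by (simp add: re_trace_poly_op_swap[OF assms(1,2)] LIMSEQ_unique)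

section \<open>Fuglede--Kadison determinants\<close>

text \<open>The regularized determinants decrease with e and stay nonnegative, so the limit in
  \<open>fk_det\<close> exists and is their infimum.\<close>

lemma fk_det_bounds:
  fixes S :: "'g::group_add ell2_op"
  assumes "op_bounds (abs_op S) 0 M" "0 < e"
  shows "0 \<le> fk_det S" "fk_det S \<le> exp (re_trace (fun_calc (\<lambda>t. ln (t + e)) (abs_op S)))"
proof -
  let ?T = "abs_op S"
  define g where "g e = exp (re_trace (fun_calc (\<lambda>t. ln (t + e)) ?T))" for e
  have cont: "continuous_on {0..M} (\<lambda>t. ln (t + e))" if "e > 0" for e :: real
    using that by (intro continuous_intros) auto
  have g_eq: "fk_det_invertible (?T + e *\<^sub>R id_blinfun) = g e" if "e > 0" for e
  proof -
    have b: "op_bounds (?T + e *\<^sub>R id_blinfun) e (M + e)"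
      using op_bounds_affine[OF assms(1), of 1 e] by simp
    have "abs_op (?T + e *\<^sub>R id_blinfun) = ?T + e *\<^sub>R id_blinfun"
    proof (rule abs_op_positive[OF op_boundsD(2)[OF b]])
      show "0 \<le> inner ((?T + e *\<^sub>R id_blinfun) x) x" for x
        using op_boundsD(3)[OF b, of x] that by (meson inner_ge_zero less_imp_le mult_nonneg_nonneg order_trans)
    qed
    moreover have "fun_calc ln (?T + e *\<^sub>R id_blinfun) = fun_calc (\<lambda>t. ln (t + e)) ?T"
    proof -
      have "fun_calc ln (fun_calc (\<lambda>t. 1 * t + e) ?T) = fun_calc (\<lambda>t. ln (1 * t + e)) ?T"
        by (rule fun_calc_compose[OF assms(1), of _ e "M + e"])
          (use that op_boundsD(1)[OF assms(1)] in \<open>auto intro!: continuous_intros\<close>)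
      then show ?thesis using fun_calc_affine[OF assms(1), of 1 e] by simp
    qed
    ultimately show ?thesis by (simp add: fk_det_invertible_def g_def Re_vN_trace)
  qed
  have mono: "g d \<le> g e" if "0 < d" "d \<le> e" for d e
    unfolding g_def exp_le_cancel_iff
    by (rule re_trace_fun_calc_mono[OF assms(1) cont cont]) (use that in auto)
  have "(g \<longlongrightarrow> Inf (g ` ({0<..} \<inter> UNIV))) (at 0 within ({0<..} \<inter> UNIV))"
    by (rule Lim_right_bound[where K = 0]) (use mono in auto, simp add: g_def)
  then have "(g \<longlongrightarrow> Inf (g ` {0<..})) (at_right 0)" by simp
  moreover have "\<forall>\<^sub>F e in at_right 0. g e = fk_det_invertible (?T + e *\<^sub>R id_blinfun)"
    using g_eq by (auto simp: eventually_at_filter)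
  ultimately have "((\<lambda>e. fk_det_invertible (?T + e *\<^sub>R id_blinfun)) \<longlongrightarrow> Inf (g ` {0<..})) (at_right 0)"
    using tendsto_cong by fast
  then have "fk_det S = Inf (g ` {0<..})"
    unfolding fk_det_def by (intro tendsto_Lim) auto
  moreover have "0 \<le> Inf (g ` {0<..})"
    by (rule cInf_greatest) (auto simp: g_def)
  moreover have "Inf (g ` {0<..}) \<le> g e"
    by (rule cInf_lower) (use assms(2) in \<open>auto intro!: bdd_belowI[of _ 0] simp: g_def\<close>)
  ultimately show "0 \<le> fk_det S" "fk_det S \<le> exp (re_trace (fun_calc (\<lambda>t. ln (t + e)) ?T))"
    by (simp_all add: g_def)
qed

section \<open>Determinants over a finite index set\<close>

text \<open>The sum of \<open>det_span\<close> for an arbitrary matrix, so that single rows can be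
  replaced.\<close>

definition leibniz_det :: "'a set \<Rightarrow> ('a \<Rightarrow> 'a \<Rightarrow> complex) \<Rightarrow> complex" where
  "leibniz_det F a = (\<Sum>p | p permutes F. of_int (sign p) * (\<Prod>g\<in>F. a g (p g)))"

lemma leibniz_det_cong:
  "(\<And>g h. g \<in> F \<Longrightarrow> h \<in> F \<Longrightarrow> a g h = b g h) \<Longrightarrow> leibniz_det F a = leibniz_det F b"
  unfolding leibniz_det_def
  by (intro sum.cong refl arg_cong2[of _ _ _ _ "(*)"] prod.cong) (auto simp: permutes_in_image)

lemma leibniz_det_row:
  assumes "finite F" "\<gamma> \<in> F"
  shows "leibniz_det F (\<lambda>g. if g = \<gamma> then r else a g) =
    (\<Sum>p | p permutes F. of_int (sign p) * (r (p \<gamma>) * (\<Prod>g\<in>F - {\<gamma>}. a g (p g))))"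
proof -
  have "(\<Prod>g\<in>F. (if g = \<gamma> then r else a g) (p g)) = r (p \<gamma>) * (\<Prod>g\<in>F - {\<gamma>}. a g (p g))" for p
    by (subst prod.remove[OF assms]) (auto intro!: arg_cong2[of _ _ _ _ "(*)"] prod.cong)
  then show ?thesis by (simp add: leibniz_det_def)
qed

lemma leibniz_det_row_sum:
  assumes "finite F" "\<gamma> \<in> F" "finite I"
  shows "leibniz_det F (\<lambda>g. if g = \<gamma> then (\<lambda>h. \<Sum>i\<in>I. c i * r i h) else a g) =
    (\<Sum>i\<in>I. c i * leibniz_det F (\<lambda>g. if g = \<gamma> then r i else a g))"
  unfolding leibniz_det_row[OF assms(1,2)] sum_distrib_left sum_distrib_right
  by (subst sum.swap) (simp add: mult_ac)

text \<open>Composition with the transposition of the two rows reverses the sign and preserves each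
  product, so the sum equals its own negative.\<close>

lemma leibniz_det_equal_rows:
  assumes "finite F" "\<gamma> \<in> F" "k \<in> F" "\<gamma> \<noteq> k" "a \<gamma> = a k"
  shows "leibniz_det F a = 0"
proof -
  let ?t = "Transposition.transpose \<gamma> k"
  have t: "?t permutes F" using assms by (simp add: permutes_swap_id)
  have "leibniz_det F a = (\<Sum>p | p permutes F. of_int (sign (p \<circ> ?t)) * (\<Prod>g\<in>F. a g ((p \<circ> ?t) g)))"
    unfolding leibniz_det_def by (rule sum_permutations_compose_right[OF t])
  also have "\<dots> = (\<Sum>p | p permutes F. - (of_int (sign p) * (\<Prod>g\<in>F. a g (p g))))"
  proof (intro sum.cong refl)
    fix p assume "p \<in> {p. p permutes F}"
    then have "sign (p \<circ> ?t) = - sign p"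
      using assms t by (simp add: sign_compose sign_swap_id permutation_swap_id permutes_imp_permutation)
    moreover have "(\<Prod>g\<in>F. a g ((p \<circ> ?t) g)) = (\<Prod>g\<in>F. a (?t g) ((p \<circ> ?t) (?t g)))"
      by (rule prod.permute[OF t, unfolded o_def])
    moreover have "a (?t g) = a g" for g
      using assms(5) by (cases "g = \<gamma>"; cases "g = k") auto
    ultimately show "of_int (sign (p \<circ> ?t)) * (\<Prod>g\<in>F. a g ((p \<circ> ?t) g))
        = - (of_int (sign p) * (\<Prod>g\<in>F. a g (p g)))"
      by simp
  qed
  also have "\<dots> = - leibniz_det F a"
    by (simp add: leibniz_det_def sum_negf)
  finally show ?thesis by simp
qed

text \<open>Laplace expansion along a row supported at \<gamma>: a permutation that moves \<gamma>
  meets a zero entry, and those that fix \<gamma> are the permutations of F.\<close>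

lemma leibniz_det_insert_row:
  assumes "finite F" "\<gamma> \<notin> F" "\<And>h. h \<in> F \<Longrightarrow> r h = 0"
  shows "leibniz_det (insert \<gamma> F) (\<lambda>g. if g = \<gamma> then r else a g) = r \<gamma> * leibniz_det F a"
proof -
  have "leibniz_det (insert \<gamma> F) (\<lambda>g. if g = \<gamma> then r else a g) =
      (\<Sum>p | p permutes insert \<gamma> F. of_int (sign p) * (r (p \<gamma>) * (\<Prod>g\<in>insert \<gamma> F - {\<gamma>}. a g (p g))))"
    using assms(1) by (intro leibniz_det_row) auto
  also have "\<dots> = (\<Sum>p | p permutes F. of_int (sign p) * (r \<gamma> * (\<Prod>g\<in>F. a g (p g))))"
  proof (rule sum.mono_neutral_cong_right)
    show "finite {p. p permutes insert \<gamma> F}" using assms(1) by (simp add: finite_permutations)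
    show "{p. p permutes F} \<subseteq> {p. p permutes insert \<gamma> F}"
      by (auto intro: permutes_subset)
    show "\<forall>p\<in>{p. p permutes insert \<gamma> F} - {p. p permutes F}.
        of_int (sign p) * (r (p \<gamma>) * (\<Prod>g\<in>insert \<gamma> F - {\<gamma>}. a g (p g))) = 0"
    proof
      fix p assume p: "p \<in> {p. p permutes insert \<gamma> F} - {p. p permutes F}"
      have "p \<gamma> \<noteq> \<gamma>"
      proof
        assume "p \<gamma> = \<gamma>"
        then have "p permutes F"
          using p permutes_superset[of p "insert \<gamma> F" F] by auto
        then show False using p by simp
      qed
      moreover have "p \<gamma> \<in> insert \<gamma> F"
        using p permutes_in_image[of p "insert \<gamma> F" \<gamma>] by simp
      ultimately show "of_int (sign p) * (r (p \<gamma>) * (\<Prod>g\<in>insert \<gamma> F - {\<gamma>}. a g (p g))) = 0"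
        using assms(3) by simp
    qed
    fix p assume "p \<in> {p. p permutes F}"
    then have "p \<gamma> = \<gamma>" using assms(2) by (auto simp: permutes_def)
    moreover have "insert \<gamma> F - {\<gamma>} = F" using assms(2) by auto
    ultimately show "of_int (sign p) * (r (p \<gamma>) * (\<Prod>g\<in>insert \<gamma> F - {\<gamma>}. a g (p g)))
        = of_int (sign p) * (r \<gamma> * (\<Prod>g\<in>F. a g (p g)))" by simp
  qed
  also have "\<dots> = r \<gamma> * leibniz_det F a"
    by (simp add: leibniz_det_def sum_distrib_left mult_ac)
  finally show ?thesis .
qed

section \<open>Finite spans and compressions\<close>

lemma Rep_ell2_sum_ket:
  assumes "finite F"
  shows "Rep_ell2 (\<Sum>g\<in>F. c g *\<^sub>C ket g) h = (if h \<in> F then c h else 0)"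
proof -
  have "Rep_ell2 (\<Sum>g\<in>F. c g *\<^sub>C ket g) h = (\<Sum>g\<in>F. if h = g then c g else 0)"
    unfolding cinner_ket[symmetric] cinner_sum_left cinner_scaleC_left
    by (intro sum.cong refl) (simp add: cinner_ket ket.rep_eq)
  then show ?thesis using assms by simp
qed

lemma Rep_ell2_simps [simp]:
  "Rep_ell2 (x + y) g = Rep_ell2 x g + Rep_ell2 y g"
  "Rep_ell2 (x - y) g = Rep_ell2 x g - Rep_ell2 y g"
  "Rep_ell2 (c *\<^sub>C x) g = c * Rep_ell2 x g"
  "Rep_ell2 0 g = 0"
  "Rep_ell2 (ket h) g = (if g = h then 1 else 0)"
  by (simp_all add: plus_ell2.rep_eq minus_ell2.rep_eq scaleC.rep_eq zero_ell2.rep_eq ket.rep_eq)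

lemma Rep_ell2_eqI: "(\<And>g. Rep_ell2 x g = Rep_ell2 y g) \<Longrightarrow> x = y"
  by (simp add: ext flip: Rep_ell2_inject)

lemma fin_span_iff:
  assumes "finite F"
  shows "x \<in> fin_span F \<longleftrightarrow> (\<forall>g. g \<notin> F \<longrightarrow> Rep_ell2 x g = 0)"
proof
  assume "x \<in> fin_span F"
  then show "\<forall>g. g \<notin> F \<longrightarrow> Rep_ell2 x g = 0"
    by (auto simp: fin_span_def Rep_ell2_sum_ket[OF assms])
next
  assume "\<forall>g. g \<notin> F \<longrightarrow> Rep_ell2 x g = 0"
  then have "x = (\<Sum>g\<in>F. Rep_ell2 x g *\<^sub>C ket g)"
    by (intro Rep_ell2_eqI) (simp add: Rep_ell2_sum_ket[OF assms])
  then show "x \<in> fin_span F"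
    unfolding fin_span_def by (rule range_eqI[where x = "Rep_ell2 x"])
qed

lemma cinner_fin_span:
  assumes "finite F" "y \<in> fin_span F"
  shows "cinner x y = (\<Sum>g\<in>F. Rep_ell2 x g * cnj (Rep_ell2 y g))"
proof -
  have "y = (\<Sum>g\<in>F. Rep_ell2 y g *\<^sub>C ket g)"
    using assms by (intro Rep_ell2_eqI) (simp add: Rep_ell2_sum_ket fin_span_iff)
  then have "cinner x y = cinner x (\<Sum>g\<in>F. Rep_ell2 y g *\<^sub>C ket g)" by simp
  then show ?thesis by (simp add: cinner_sum_right cinner_scaleC_right cinner_ket mult.commute)
qed

lemma Rep_ell2_proj_span:
  assumes "finite F"
  shows "Rep_ell2 (proj_span F x) g = (if g \<in> F then Rep_ell2 x g else 0)"
proof -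
  define y where "y = (\<Sum>g\<in>F. Rep_ell2 x g *\<^sub>C ket g)"
  have y: "Rep_ell2 y g = (if g \<in> F then Rep_ell2 x g else 0)" for g
    by (simp add: y_def Rep_ell2_sum_ket[OF assms])
  have "proj_span F x = y"
    unfolding proj_span_def
  proof (rule the_equality)
    show "y \<in> fin_span F \<and> (\<forall>z\<in>fin_span F. cinner (x - y) z = 0)"
      by (simp add: fin_span_iff[OF assms] y cinner_fin_span[OF assms])
    fix y' assume y': "y' \<in> fin_span F \<and> (\<forall>z\<in>fin_span F. cinner (x - y') z = 0)"
    show "y' = y"
    proof (rule Rep_ell2_eqI)
      fix g
      show "Rep_ell2 y' g = Rep_ell2 y g"
      proof (cases "g \<in> F")
        case True
        then have "ket g \<in> fin_span F" by (auto simp: fin_span_iff[OF assms])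
        with y' have "cinner (x - y') (ket g) = 0" by blast
        then show ?thesis using True by (simp add: cinner_ket y)
      next
        case False
        then show ?thesis using y' by (simp add: y fin_span_iff[OF assms])
      qed
    qed
  qed
  then show ?thesis by (simp add: y)
qed

lemma det_span_compression:
  assumes "finite F"
  shows "det_span F (compression F A) = leibniz_det F (\<lambda>g h. Rep_ell2 (A (ket h)) g)"
  unfolding det_span_def leibniz_det_def
  by (intro sum.cong refl arg_cong2[of _ _ _ _ "(*)"] prod.cong)
    (simp add: compression_def Rep_ell2_proj_span[OF assms])

section \<open>Positive forms on finite spans and the quotient of determinants\<close>

context
  fixes A :: "'g::group_add ell2_op"
  assumes hermitian: "hermitian A" and nonneg: "\<And>x. 0 \<le> inner (A x) x"
    and inj: "inj_on A group_ring"
begin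

text \<open>For a positive operator, (A x, x) = 0 forces A x = 0, which injectivity excludes for
  nonzero x of finite support.\<close>

lemma form_positive:
  assumes "finite F" "x \<in> fin_span F" "x \<noteq> 0"
  shows "0 < inner (A x) x"
proof (rule ccontr)
  assume "\<not> 0 < inner (A x) x"
  then have 0: "inner (A x) x = 0" using nonneg[of x] by simp
  define n where "n = inner (A x) (A x)"
  define c where "c = inner (A (A x)) (A x)"
  have c: "0 \<le> c" unfolding c_def by (rule nonneg)
  \<comment> \<open>The form at x + t A x equals t (2 n + t c), with minimizer - n / c; the
    denominator c + 1 avoids a division by zero and still gives a negative value unless n =
    0.\<close>
  define t where "t = - n / (c + 1)"
  have "0 \<le> inner (A (x + t *\<^sub>R A x)) (x + t *\<^sub>R A x)" by (rule nonneg)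
  also have "\<dots> = t * (2 * n + t * c)"
    using 0 hermitian_inner[OF hermitian, of "A x" x]
    by (simp add: n_def c_def blinfun.add_right blinfun.scaleR_right inner_add inner_commute algebra_simps)
  also have "\<dots> = - (n\<^sup>2 * (c + 2)) / (c + 1)\<^sup>2"
    using c by (simp add: t_def divide_simps) (simp add: algebra_simps power2_eq_square)
  finally have "n\<^sup>2 * (c + 2) \<le> 0"
    using c by (simp add: divide_simps split: if_splits)
  then have "n = 0" using c by (simp add: mult_le_0_iff)
  then have "A x = A 0" by (simp add: n_def blinfun.zero_right)
  moreover have "x \<in> group_ring" "0 \<in> group_ring"
    using assms by (auto simp: group_ring_def fin_span_iff intro!: exI[of _ F])
  ultimately show False using inj_onD[OF inj] assms(3) by blast
qed

text \<open>This is surjectivity of the compression, by Gram-Schmidt for the form of A: subtracting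
  from \<gamma> its projection w gives a vector \<Phi> with A \<Phi> zero on F, and a multiple of
  \<Phi> corrects the coordinate at \<gamma> without disturbing F.\<close>

lemma form_projection_exists:
  assumes "finite F"
  shows "\<exists>u\<in>fin_span F. \<forall>g\<in>F. Rep_ell2 (A u) g = Rep_ell2 v g"
  using assms
proof (induction F arbitrary: v rule: finite_induct)
  case empty
  have "0 \<in> fin_span {}" by (simp add: fin_span_iff)
  then show ?case by auto
next
  case (insert \<gamma> F)
  obtain w where w: "w \<in> fin_span F" "\<And>g. g \<in> F \<Longrightarrow> Rep_ell2 (A w) g = Rep_ell2 (A (ket \<gamma>)) g"
    using insert.IH by blast
  obtain u where u: "u \<in> fin_span F" "\<And>g. g \<in> F \<Longrightarrow> Rep_ell2 (A u) g = Rep_ell2 v g"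
    using insert.IH by blast
  define \<Phi> where "\<Phi> = ket \<gamma> - w"
  have fin: "finite (insert \<gamma> F)" using insert.hyps by simp
  have \<Phi>: "\<Phi> \<in> fin_span (insert \<gamma> F)" "Rep_ell2 \<Phi> \<gamma> = 1"
    using w(1) insert.hyps by (auto simp: \<Phi>_def fin_span_iff)
  have A\<Phi>: "Rep_ell2 (A \<Phi>) g = 0" if "g \<in> F" for g
    using w(2)[OF that] by (simp add: \<Phi>_def blinfun.diff_right)
  have "cinner (A \<Phi>) \<Phi> = Rep_ell2 (A \<Phi>) \<gamma>"
    using insert.hyps A\<Phi> \<Phi>(2) by (simp add: cinner_fin_span[OF fin \<Phi>(1)])
  moreover have "\<Phi> \<noteq> 0" using \<Phi>(2) by auto
  then have "cinner (A \<Phi>) \<Phi> \<noteq> 0"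
    using form_positive[OF fin \<Phi>(1)] by (metis Re_cinner less_irrefl zero_complex.simps(1))
  ultimately have d: "Rep_ell2 (A \<Phi>) \<gamma> \<noteq> 0" by simp
  define c where "c = (Rep_ell2 v \<gamma> - Rep_ell2 (A u) \<gamma>) / Rep_ell2 (A \<Phi>) \<gamma>"
  \<comment> \<open>Complex linearity is recovered from the Hermitian identity, as the context does
    not assume it.\<close>
  have lin: "A (b *\<^sub>C x) = b *\<^sub>C A x" for b x
    by (rule ell2_eqI) (metis cinner_scaleC_left hermitian hermitian_def)
  have "u + c *\<^sub>C \<Phi> \<in> fin_span (insert \<gamma> F)"
    using u(1) \<Phi>(1) insert.hyps by (auto simp: fin_span_iff)
  moreover have "Rep_ell2 (A (u + c *\<^sub>C \<Phi>)) g = Rep_ell2 v g" if "g \<in> insert \<gamma> F" for g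
    using that A\<Phi> u(2) d by (auto simp: blinfun.add_right lin c_def)
  ultimately show ?case by blast
qed

text \<open>Adding multiples of the other rows to row \<gamma>, whose own coefficient is 1,
  preserves the determinant. The new row consists of the conjugate coordinates of A \<Phi>, which
  vanish on F.\<close>

lemma leibniz_det_insert:
  assumes "finite F" "\<gamma> \<notin> F" "\<Phi> \<in> fin_span (insert \<gamma> F)" "Rep_ell2 \<Phi> \<gamma> = 1"
    "\<And>g. g \<in> F \<Longrightarrow> Rep_ell2 (A \<Phi>) g = 0"
  shows "leibniz_det (insert \<gamma> F) (\<lambda>g h. Rep_ell2 (A (ket h)) g)
    = complex_of_real (inner (A \<Phi>) \<Phi>) * leibniz_det F (\<lambda>g h. Rep_ell2 (A (ket h)) g)"
proof -
  let ?F = "insert \<gamma> F" and ?G = "\<lambda>g h. Rep_ell2 (A (ket h)) g"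
  have fin: "finite ?F" using assms(1) by simp
  \<comment> \<open>The coefficients are conjugated so that r h is (A h, \<Phi>), which symmetry
    turns into the conjugate of (A \<Phi>, h).\<close>
  define r where "r = (\<lambda>h. \<Sum>k\<in>?F. cnj (Rep_ell2 \<Phi> k) * ?G k h)"
  have r: "r h = cnj (Rep_ell2 (A \<Phi>) h)" for h
  proof -
    have "r h = cinner (A (ket h)) \<Phi>"
      by (simp add: r_def cinner_fin_span[OF fin assms(3)] mult.commute)
    also have "\<dots> = cnj (cinner (A \<Phi>) (ket h))"
      using hermitian cinner_commute unfolding hermitian_def by metis
    finally show ?thesis by (simp add: cinner_ket)
  qed
  have "cinner (A \<Phi>) \<Phi> = Rep_ell2 (A \<Phi>) \<gamma>"
    using assms by (simp add: cinner_fin_span[OF fin assms(3)])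
  moreover have "cnj (cinner (A \<Phi>) \<Phi>) = cinner (A \<Phi>) \<Phi>"
    using hermitian cinner_commute unfolding hermitian_def by metis
  ultimately have "Im (Rep_ell2 (A \<Phi>) \<gamma>) = 0" "Re (Rep_ell2 (A \<Phi>) \<gamma>) = inner (A \<Phi>) \<Phi>"
    by (auto simp: complex_eq_iff Re_cinner[symmetric])
  then have r\<gamma>: "r \<gamma> = complex_of_real (inner (A \<Phi>) \<Phi>)"
    by (simp add: r complex_eq_iff)
  have "leibniz_det ?F (\<lambda>g. if g = \<gamma> then r else ?G g) =
      (\<Sum>k\<in>?F. cnj (Rep_ell2 \<Phi> k) * leibniz_det ?F (\<lambda>g. if g = \<gamma> then ?G k else ?G g))"
    unfolding r_def using fin by (intro leibniz_det_row_sum) auto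
  also have "\<dots> = leibniz_det ?F (\<lambda>g. if g = \<gamma> then ?G \<gamma> else ?G g) +
      (\<Sum>k\<in>F. cnj (Rep_ell2 \<Phi> k) * leibniz_det ?F (\<lambda>g. if g = \<gamma> then ?G k else ?G g))"
    using assms by simp
  also have "(\<Sum>k\<in>F. cnj (Rep_ell2 \<Phi> k) * leibniz_det ?F (\<lambda>g. if g = \<gamma> then ?G k else ?G g)) = 0"
  proof (intro sum.neutral ballI)
    fix k assume "k \<in> F"
    then have "leibniz_det ?F (\<lambda>g. if g = \<gamma> then ?G k else ?G g) = 0"
      using assms(2) by (intro leibniz_det_equal_rows[OF fin, of \<gamma> k]) auto
    then show "cnj (Rep_ell2 \<Phi> k) * leibniz_det ?F (\<lambda>g. if g = \<gamma> then ?G k else ?G g) = 0" by simp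
  qed
  also have "leibniz_det ?F (\<lambda>g. if g = \<gamma> then ?G \<gamma> else ?G g) = leibniz_det ?F ?G"
    by (rule leibniz_det_cong) simp
  finally have "leibniz_det ?F ?G = leibniz_det ?F (\<lambda>g. if g = \<gamma> then r else ?G g)" by simp
  also have "\<dots> = r \<gamma> * leibniz_det F ?G"
    using assms by (intro leibniz_det_insert_row) (auto simp: r)
  finally show ?thesis by (simp add: r\<gamma>)
qed

text \<open>Starting from the empty determinant 1, each new element contributes a factor (A \<Phi>,
  \<Phi>) > 0. This legitimates the quotient.\<close>

lemma leibniz_det_nonzero:
  assumes "finite F"
  shows "leibniz_det F (\<lambda>g h. Rep_ell2 (A (ket h)) g) \<noteq> 0"
  using assms
proof (induction F rule: finite_induct)
  case empty
  show ?case by (simp add: leibniz_det_def)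
next
  case (insert \<gamma> F)
  obtain w where w: "w \<in> fin_span F" "\<And>g. g \<in> F \<Longrightarrow> Rep_ell2 (A w) g = Rep_ell2 (A (ket \<gamma>)) g"
    using form_projection_exists[OF insert.hyps(1)] by blast
  have \<Phi>: "ket \<gamma> - w \<in> fin_span (insert \<gamma> F)" "Rep_ell2 (ket \<gamma> - w) \<gamma> = 1"
    using w(1) insert.hyps by (auto simp: fin_span_iff)
  have "ket \<gamma> - w \<noteq> 0" using \<Phi>(2) by (metis Rep_ell2_simps(4) zero_neq_one)
  with \<Phi>(1) have "0 < inner (A (ket \<gamma> - w)) (ket \<gamma> - w)"
    using insert.hyps(1) by (intro form_positive[of "insert \<gamma> F"]) auto
  moreover have "Rep_ell2 (A (ket \<gamma> - w)) g = 0" if "g \<in> F" for g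
    using w(2)[OF that] by (simp add: blinfun.diff_right)
  ultimately show ?case
    using leibniz_det_insert[OF insert.hyps \<Phi>] insert.IH by simp
qed

text \<open>\<open>inv_into\<close> returns a genuine preimage because the projected vector lies in
  the image of the span. The equation for that preimage says that A \<Phi> is orthogonal to
  F.\<close>

lemma Phi_properties:
  assumes "finite F" "\<gamma> \<notin> F"
  shows "Phi A F \<gamma> \<in> fin_span (insert \<gamma> F)" "Rep_ell2 (Phi A F \<gamma>) \<gamma> = 1"
    "\<And>g. g \<in> F \<Longrightarrow> Rep_ell2 (A (Phi A F \<gamma>)) g = 0"
proof -
  define v where "v = proj_span F (A (ket \<gamma>))"
  define u where "u = inv_into (fin_span F) (compression F A) v"
  obtain w where w: "w \<in> fin_span F" "\<And>g. g \<in> F \<Longrightarrow> Rep_ell2 (A w) g = Rep_ell2 (A (ket \<gamma>)) g"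
    using form_projection_exists[OF assms(1)] by blast
  then have "compression F A w = v"
    by (intro Rep_ell2_eqI) (simp add: compression_def v_def Rep_ell2_proj_span[OF assms(1)])
  then have "v \<in> compression F A ` fin_span F" using w(1) by blast
  then have u: "u \<in> fin_span F" "compression F A u = v"
    unfolding u_def by (auto intro: inv_into_into f_inv_into_f)
  have Phi: "Phi A F \<gamma> = ket \<gamma> - u"
    by (simp add: Phi_def u_def v_def)
  show "Phi A F \<gamma> \<in> fin_span (insert \<gamma> F)" "Rep_ell2 (Phi A F \<gamma>) \<gamma> = 1"
    using u(1) assms by (auto simp: Phi fin_span_iff)
  fix g assume "g \<in> F"
  then show "Rep_ell2 (A (Phi A F \<gamma>)) g = 0"
    using arg_cong[OF u(2), of "\<lambda>x. Rep_ell2 x g"] assms(1)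
    by (simp add: Phi blinfun.diff_right compression_def v_def Rep_ell2_proj_span)
qed

lemma det_span_ratio:
  assumes "finite F" "\<gamma> \<notin> F"
  shows "det_span (insert \<gamma> F) (compression (insert \<gamma> F) A) / det_span F (compression F A)
    = complex_of_real (inner (A (Phi A F \<gamma>)) (Phi A F \<gamma>))"
  using leibniz_det_insert[OF assms Phi_properties[OF assms]] leibniz_det_nonzero[OF assms(1)] assms(1)
  by (simp add: det_span_compression)

end

section \<open>The inequality\<close>

lemma cinner_right_mult_left: "cinner (right_mult (- \<gamma>) x) y = cinner x (right_mult \<gamma> y)"
proof transfer
  fix \<gamma> :: 'a and x y :: "'a \<Rightarrow> complex"
  show "(\<Sum>\<^sub>\<infinity>g. x (g - - \<gamma>) * cnj (y g)) = (\<Sum>\<^sub>\<infinity>g. x g * cnj (y (g - \<gamma>)))"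
    using infsum_reindex_bij_betw[OF bij_group_translations(2)[of \<gamma>], of "\<lambda>g. x (g + \<gamma>) * cnj (y g)"]
    by simp
qed

text \<open>Being again a finite sum of right translations, this explicit adjoint is tracial for the
  same reason as \<open>ring_op\<close>.\<close>

definition ring_op_adjoint :: "'g::group_add ell2 \<Rightarrow> 'g ell2_op" where
  "ring_op_adjoint f = (\<Sum>\<gamma> | Rep_ell2 f \<gamma> \<noteq> 0. scalar_op (cnj (Rep_ell2 f \<gamma>)) o\<^sub>L right_mult_op \<gamma>)"

lemma cinner_ring_op: "cinner (ring_op f x) y = cinner x (ring_op_adjoint f y)"
  by (simp add: ring_op_def ring_op_adjoint_def blinfun.sum_left cinner_sum_left cinner_sum_right
      scalar_op.rep_eq right_mult_op.rep_eq cinner_scaleC_left cinner_scaleC_right cinner_right_mult_left)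

lemma tracial_ring_op_adjoint: "tracial (ring_op_adjoint f)"
  unfolding ring_op_adjoint_def by (intro tracial_sum tracial_compose tracial_scalar tracial_right_mult)

lemma ring_op_tilde_ket:
  assumes "finite F" "f \<in> fin_span F"
  shows "ring_op (tilde f) (ket 0) = f"
proof -
  let ?S = "{\<gamma>. Rep_ell2 (tilde f) \<gamma> \<noteq> 0}"
  \<comment> \<open>Finiteness of the support matters: a sum over an infinite index set is 0 by
    convention.\<close>
  have "?S \<subseteq> uminus ` F"
    using assms by (auto simp: fin_span_iff tilde.rep_eq intro!: image_eqI[of _ uminus "- _"])
  then have fin: "finite ?S" using assms(1) finite_subset by blast
  show ?thesis
  proof (rule Rep_ell2_eqI)
    fix g
    have "Rep_ell2 (ring_op (tilde f) (ket 0)) g = (\<Sum>\<gamma>\<in>?S. if \<gamma> = - g then Rep_ell2 f g else 0)"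
      unfolding cinner_ket[of _ g, symmetric] ring_op_def blinfun.sum_left cinner_sum_left
      by (intro sum.cong refl)
        (auto simp: scalar_op.rep_eq right_mult_op.rep_eq right_mult_ket cinner_scaleC_left cinner_ket tilde.rep_eq)
    also have "\<dots> = Rep_ell2 f g"
      using fin by (simp add: tilde.rep_eq)
    finally show "Rep_ell2 (ring_op (tilde f) (ket 0)) g = Rep_ell2 f g" .
  qed
qed

lemma fun_calc_cmult:
  assumes "op_bounds A m M" "continuous_on {m..M} f"
  shows "fun_calc (\<lambda>t. c * f t) A = c *\<^sub>R fun_calc f A"
proof -
  have "fun_calc (\<lambda>_. c) A = c *\<^sub>R id_blinfun"
    using fun_calc_affine[OF assms(1), of 0 c] by simp
  then show ?thesis
    using fun_calc_add_const_mult[OF assms(1) continuous_on_const assms(2), of 0 c]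
    by (simp add: blinfun_compose_bilinear)
qed

text \<open>
  The bound \<open>(\<surd>t + e)\<^sup>2 \<le> (1 + e) t + e + e\<^sup>2\<close> replaces \<open>(|B\<^sup>*| + e)\<^sup>2\<close> by a polynomial in \<open>B B\<^sup>*\<close>,
  for which the trace property is available.
\<close>

lemma fk_det_product_le:
  fixes A B C :: "'g::group_add ell2_op"
  assumes A: "A \<in> vN_algebra" "hermitian A" "\<And>x. 0 \<le> inner (A x) x"
    and B: "tracial B" "tracial C" "\<And>x y. cinner (B x) y = cinner x (C y)"
  shows "fk_det A * (fk_det B)\<^sup>2 \<le> re_trace (A o\<^sub>L (B o\<^sub>L C))"
proof -
  \<comment> \<open>A common interval for C B and B C, so that one function can be carried from one
    to the other under the trace.\<close>
  define M where "M = max (norm (C o\<^sub>L B)) (norm (B o\<^sub>L C)) + 1"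
  have M: "0 < M" unfolding M_def by (smt (verit) norm_ge_zero)
  have CB: "cinner (C x) y = cinner x (B y)" for x y
    using B(3) cinner_commute by metis
  have widen: "op_bounds T 0 M" if "op_bounds T 0 M'" "M' \<le> M" for T :: "'g ell2_op" and M'
    unfolding op_bounds_def
  proof (intro conjI allI)
    show "0 < M" by (rule M)
    show "hermitian T" using op_boundsD(2)[OF that(1)] .
    fix x
    show "0 * inner x x \<le> inner (T x) x" using op_boundsD(3)[OF that(1)] .
    show "inner (T x) x \<le> M * inner x x"
      using op_boundsD(4)[OF that(1), of x] mult_right_mono[OF that(2), of "inner x x"] by simp
  qed
  have bCB: "op_bounds (C o\<^sub>L B) 0 M"
  proof (rule widen[OF op_bounds_positive])
    show "hermitian (C o\<^sub>L B)" by (simp add: hermitian_def CB B(3))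
    show "0 \<le> inner ((C o\<^sub>L B) x) x" for x
      using arg_cong[OF CB[of "B x" x], of Re] by (simp add: Re_cinner)
  qed (simp add: M_def)
  have bBC: "op_bounds (B o\<^sub>L C) 0 M"
  proof (rule widen[OF op_bounds_positive])
    show "hermitian (B o\<^sub>L C)" by (simp add: hermitian_def CB B(3))
    show "0 \<le> inner ((B o\<^sub>L C) x) x" for x
      using arg_cong[OF B(3)[of "C x" x], of Re] by (simp add: Re_cinner)
  qed (simp add: M_def)
  have abs_B: "abs_op B = fun_calc sqrt (C o\<^sub>L B)"
    using adj_op_eqI[OF B(3)] by (simp add: abs_op_def)
  have sqrt_cont: "continuous_on {0..M} sqrt" by (intro continuous_intros)
  have sqrt_range: "sqrt ` {0..M} \<subseteq> {0..sqrt M}" by auto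
  have b_abs: "op_bounds (abs_op B) 0 (sqrt M)"
    unfolding abs_B by (rule fun_calc_op_bounds[OF bCB sqrt_cont _ sqrt_range]) (use M in simp)
  define N where "N = norm A + 1"
  have bA: "op_bounds A 0 N" unfolding N_def by (rule op_bounds_positive[OF A(2,3)])
  have abs_A: "abs_op A = A" by (rule abs_op_positive[OF A(2,3)])
  \<comment> \<open>The factor 1 gives X the affine form to which \<open>fun_calc_affine\<close>
    applies.\<close>
  have main: "fk_det A * (fk_det B)\<^sup>2 \<le>
      re_trace ((1 *\<^sub>R A + e *\<^sub>R id_blinfun) o\<^sub>L ((1 + e) *\<^sub>R (B o\<^sub>L C) + (e + e\<^sup>2) *\<^sub>R id_blinfun))"
    (is "_ \<le> re_trace (?X o\<^sub>L ?Y)") if e: "0 < e" for e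
  proof -
    have lnA: "continuous_on {0..N} (\<lambda>t. ln (t + e))"
      using e by (intro continuous_intros) auto
    have bX: "op_bounds ?X e (N + e)"
      using op_bounds_affine[OF bA, of 1 e] by simp
    have bY: "op_bounds ?Y (e + e\<^sup>2) ((1 + e) * M + (e + e\<^sup>2))"
      using op_bounds_affine[OF bBC, of "1 + e" "e + e\<^sup>2"] e by simp
    have pos: "0 < e + e\<^sup>2" using e by (simp add: add_pos_pos)
    have "fun_calc ln ?X = fun_calc ln (fun_calc (\<lambda>t. 1 * t + e) A)"
      by (simp only: fun_calc_affine[OF bA])
    also have "\<dots> = fun_calc (\<lambda>t. ln (1 * t + e)) A"
      by (rule fun_calc_compose[OF bA, of _ e "N + e"])
        (use e op_boundsD(1)[OF bA] in \<open>auto intro!: continuous_intros\<close>)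
    finally have X: "fun_calc ln ?X = fun_calc (\<lambda>t. ln (t + e)) A" by simp
    have fA: "fk_det A \<le> exp (re_trace (fun_calc ln ?X))"
      unfolding X using fk_det_bounds(2)[of A N e] bA e by (simp add: abs_A)
    \<comment> \<open>The shift sits outside the root because \<open>fk_det\<close> regularizes |B|
      and not its square.\<close>
    define h where "h = (\<lambda>t::real. ln (sqrt t + e))"
    have h: "continuous_on {0..M} h"
      unfolding h_def using e by (intro continuous_intros) (auto simp: add_nonneg_eq_0_iff)
    have "fun_calc (\<lambda>t. ln (t + e)) (abs_op B) = fun_calc h (C o\<^sub>L B)"
      unfolding abs_B h_def
      by (rule fun_calc_compose[OF bCB sqrt_cont _ sqrt_range])
        (use M e in \<open>auto intro!: continuous_intros\<close>)
    then have "fk_det B \<le> exp (re_trace (fun_calc h (C o\<^sub>L B)))"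
      using fk_det_bounds(2)[OF b_abs e] by simp
    \<comment> \<open>|B| comes from C B, whereas the cyclic form of the trace pairs A with B
      C.\<close>
    also have "re_trace (fun_calc h (C o\<^sub>L B)) = re_trace (fun_calc h (B o\<^sub>L C))"
      by (rule re_trace_fun_calc_swap[OF B(2) tracial_vN[OF B(1)] bCB bBC h])
    finally have "(fk_det B)\<^sup>2 \<le> (exp (re_trace (fun_calc h (B o\<^sub>L C))))\<^sup>2"
      by (rule power_mono) (rule fk_det_bounds(1)[OF b_abs e])
    also have "\<dots> = exp (re_trace (fun_calc (\<lambda>t. 2 * h t) (B o\<^sub>L C)))"
      by (simp add: fun_calc_cmult[OF bBC h] re_trace_scaleR exp_double)
    also have "\<dots> \<le> exp (re_trace (fun_calc (\<lambda>t. ln ((1 + e) * t + (e + e\<^sup>2))) (B o\<^sub>L C)))"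
    proof (simp only: exp_le_cancel_iff, rule re_trace_fun_calc_mono[OF bBC])
      show "continuous_on {0..M} (\<lambda>t. 2 * h t)" using h by (intro continuous_intros)
      have "(1 + e) * t + (e + e\<^sup>2) \<noteq> 0" if "t \<in> {0..M}" for t
        using that e pos by (smt (verit) atLeastAtMost_iff mult_nonneg_nonneg)
      then show "continuous_on {0..M} (\<lambda>t. ln ((1 + e) * t + (e + e\<^sup>2)))"
        by (intro continuous_intros) auto
      fix t assume "t \<in> {0..M}"
      then have t: "0 \<le> t" by simp
      \<comment> \<open>The cross term 2 e sqrt t is bounded by e (t + 1), which explains the
        coefficients 1 + e and e + e^2 of Y.\<close>
      have "0 \<le> (sqrt t - 1)\<^sup>2" by simp
      then have "2 * sqrt t \<le> t + 1" using t by (simp add: power2_diff)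
      then have "e * (2 * sqrt t) \<le> e * (t + 1)" using e by (intro mult_left_mono) auto
      then have "(sqrt t + e)\<^sup>2 \<le> (1 + e) * t + (e + e\<^sup>2)"
        using t by (simp add: power2_sum algebra_simps)
      moreover have "0 < sqrt t + e" using t e by (simp add: add_nonneg_pos)
      ultimately have "ln ((sqrt t + e)\<^sup>2) \<le> ln ((1 + e) * t + (e + e\<^sup>2))"
        by (intro ln_mono) auto
      then show "2 * h t \<le> ln ((1 + e) * t + (e + e\<^sup>2))"
        using \<open>0 < sqrt t + e\<close> by (simp add: h_def ln_realpow)
    qed
    also have "fun_calc (\<lambda>t. ln ((1 + e) * t + (e + e\<^sup>2))) (B o\<^sub>L C) =
        fun_calc ln (fun_calc (\<lambda>t. (1 + e) * t + (e + e\<^sup>2)) (B o\<^sub>L C))"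
    proof (rule fun_calc_compose[OF bBC, symmetric])
      show "e + e\<^sup>2 < (1 + e) * M + (e + e\<^sup>2)" using op_boundsD(1)[OF bY] .
      show "(\<lambda>t. (1 + e) * t + (e + e\<^sup>2)) ` {0..M} \<subseteq> {e + e\<^sup>2..(1 + e) * M + (e + e\<^sup>2)}"
        using e by (auto intro!: mult_left_mono)
    qed (use pos in \<open>auto intro!: continuous_intros\<close>)
    also have "\<dots> = fun_calc ln ?Y" by (simp only: fun_calc_affine[OF bBC])
    finally have fB: "(fk_det B)\<^sup>2 \<le> exp (re_trace (fun_calc ln ?Y))" .
    have "fk_det A * (fk_det B)\<^sup>2 \<le> exp (re_trace (fun_calc ln ?X)) * exp (re_trace (fun_calc ln ?Y))"
      using fA fB by (intro mult_mono) auto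
    also have "\<dots> = exp (re_trace (fun_calc ln ?X) + re_trace (fun_calc ln ?Y))"
      by (simp add: exp_add)
    also have "\<dots> \<le> re_trace (?X o\<^sub>L ?Y)"
    proof (rule exp_re_trace_ln_le[OF bX e _ bY pos])
      show "?X \<in> vN_algebra" by (intro vN_algebra_add vN_algebra_scaleR A(1) vN_algebra_id)
      show "tracial ?Y" by (intro tracial_add tracial_scaleR tracial_compose B(1,2) tracial_id)
    qed
    finally show ?thesis .
  qed
  have "((\<lambda>e. re_trace ((1 *\<^sub>R A + e *\<^sub>R id_blinfun) o\<^sub>L ((1 + e) *\<^sub>R (B o\<^sub>L C) + (e + e\<^sup>2) *\<^sub>R id_blinfun)))
      \<longlongrightarrow> re_trace ((1 *\<^sub>R A + 0 *\<^sub>R id_blinfun) o\<^sub>L ((1 + 0) *\<^sub>R (B o\<^sub>L C) + (0 + 0\<^sup>2) *\<^sub>R id_blinfun)))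
      (at_right 0)"
    unfolding re_trace_def
    by (intro tendsto_intros blinfun.tendsto bounded_bilinear.tendsto[OF bounded_bilinear_blinfun_compose])
  then have "((\<lambda>e. re_trace ((1 *\<^sub>R A + e *\<^sub>R id_blinfun) o\<^sub>L ((1 + e) *\<^sub>R (B o\<^sub>L C) + (e + e\<^sup>2) *\<^sub>R id_blinfun)))
      \<longlongrightarrow> re_trace (A o\<^sub>L (B o\<^sub>L C))) (at_right 0)"
    by simp
  then show ?thesis
    by (rule tendsto_lowerbound) (use main in \<open>auto simp: eventually_at_filter\<close>)
qed

theorem corollary12:
  fixes A :: "'g::{group_add, countable} ell2_op" and F F' :: "'g set" and \<gamma> :: 'g
  assumes "A \<in> vN_algebra"
    and "positive_op A"
    and "inj_on A group_ring"
    and "finite F"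
    and "\<gamma> \<notin> F"
    and "F' = insert \<gamma> F"
  shows "complex_of_real (fk_det A * (fk_det (ring_op (tilde (Phi A F \<gamma>))))\<^sup>2)
    \<le> det_span F' (compression F' A) / det_span F (compression F A)"
proof -
  define \<Phi> where "\<Phi> = Phi A F \<gamma>"
  define B where "B = ring_op (tilde \<Phi>)"
  define C where "C = ring_op_adjoint (tilde \<Phi>)"
  have herm: "hermitian A"
    by (rule positive_op_hermitian[OF vN_algebraD(1)[OF assms(1)] assms(2)])
  have nonneg: "0 \<le> inner (A x) x" for x
    using assms(2) by (simp add: positive_op_def less_eq_complex_def Re_cinner)
  have adj: "cinner (B x) y = cinner x (C y)" for x y
    by (simp add: B_def C_def cinner_ring_op)
  have tr: "tracial B" "tracial C"
    by (simp_all add: B_def C_def tracial_ring_op tracial_ring_op_adjoint)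
  have "B (ket 0) = \<Phi>"
    using ring_op_tilde_ket[of "insert \<gamma> F" \<Phi>] Phi_properties(1)[OF herm nonneg assms(3-5)] assms(4)
    by (simp add: B_def \<Phi>_def)
  have "fk_det A * (fk_det B)\<^sup>2 \<le> re_trace (A o\<^sub>L (B o\<^sub>L C))"
    by (rule fk_det_product_le[OF assms(1) herm nonneg tr adj])
  also have "\<dots> = re_trace (C o\<^sub>L (A o\<^sub>L B))"
    using re_trace_commute[OF tr(2) vN_algebra_compose[OF assms(1) tracial_vN[OF tr(1)]]]
    by (simp add: blinfun_compose_assoc)
  also have "\<dots> = inner (A \<Phi>) \<Phi>"
    using arg_cong[OF adj[of "ket 0" "A \<Phi>"], of Re] \<open>B (ket 0) = \<Phi>\<close>
    by (simp add: re_trace_def Re_cinner inner_commute)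
  finally show ?thesis
    using det_span_ratio[OF herm nonneg assms(3-5)]
    by (simp add: assms(6) B_def \<Phi>_def less_eq_complex_def del: of_real_mult of_real_power)
qed

end
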